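(* Let $\mathsf{concatL}$ be the list concatenation program (flattening a list of lists), a closed Cedille term of type $\forall A{:}\star.\ \mathsf{List}\cdot(\mathsf{List}\cdot A)\to\mathsf{List}\cdot A$, let $\mathsf{lengthDistConcat}$ be a proof of $\forall A{:}\star.\forall n{:}\mathsf{Nat}.\Pi xss{:}\mathsf{List}\cdot(\mathsf{VecL}\cdot A\ n).\ \mathsf{mult}\ (\mathsf{length}\cdot(\mathsf{VecL}\cdot A\ n)\ xss)\ n\simeq\mathsf{length}\ (\mathsf{concatL}\cdot A\ (\mathsf{u2l\text{-}l2l}\cdot A\ {-}n\ xss))$, and define vector concatenation by reuse, $\mathsf{concatV}:\forall A{:}\star.\forall n{:}\mathsf{Nat}.\forall m{:}\mathsf{Nat}.\ \mathsf{Vec}\cdot(\mathsf{Vec}\cdot A\ n)\ m\to\mathsf{Vec}\cdot A\ (\mathsf{mult}\ m\ n)$, as $$\begin{aligned}\mathsf{concatV}=\ &\Lambda A.\Lambda n.\Lambda m.\lambda xss.\ \rho\ (\mathsf{v2u}\cdot(\mathsf{Vec}\cdot A\ n)\ {-}m\ xss).2-\\ &\rho\ (\mathsf{lengthDistConcat}\cdot A\ {-}n\ (\mathsf{v2u\text{-}v2l}\cdot A\ {-}n\ {-}m\ xss))-\\ &(\mathsf{l2v}\cdot A\ (\mathsf{concatL}\cdot A\ (\mathsf{v2l\text{-}v2l}\cdot A\ {-}n\ {-}m\ xss))).\end{aligned}$$ Then the erasure of $\mathsf{concatV}$ is the erasure of $\mathsf{concatL}$: $|\mathsf{concatV}| 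=_{\alpha\beta\eta}|\mathsf{concatL}|$.
   Context: **Terms and erasure.** Terms are those of Cedille (type theory $\iota\lambda P2$), a type-annotated Curry-style dependent type theory. $\star$ is the kind of types; $\lambda x.\,t$ and $t\ t'$ are explicit abstraction and application (types $\Pi x{:}T.\,T'$, or $T\to T'$); $\Lambda x.\,t$ is implicit (erased) abstraction over a value or a type (types $\forall x{:}T.\,T'$, or $T\Rightarrow T'$ if non-dependent), with implicit value application $t\ {-}t'$ and type application $t\cdot T$; $[t,t']$, $t.1$, $t.2$ are the introduction and projections of the dependent intersection type $\iota x{:}T.\,T'$; $\beta$ and $\beta\{t\}$ are reflexivity proofs of the heterogeneous equality type $t_1\simeq t_2$; $\rho\ q - t$ is $t$ with its type rewritten by the equality proof $q$; $\varsigma\ q$ is symmetry of $q$. Erasure $|\cdot|$ maps annotated terms to untyped $\lambda$-terms: $|x|=x$, $|\lambda x.t|=\lambda x.|t|$, $|t\ t'|=|t|\ |t'|$, $|\Lambda x.t|=|t|$, $|t\ {-}t'|=|t|$, $|t\cdot T|=|t|$, $|[t,t']|=|t|$, $|t.1|=|t.2|=|t|$, $|\beta\{t\}|=|t|$, $|\beta|=\lambda x.x$, $|\rho\ q - t|=|t|$. Defined constants are unfolded. Erased terms are compared up to $\alpha\beta\eta$-equality. Type information does not affect erasure. **Lists.** $\mathsf{ListC}\cdot A=\forall X{:}\star.\ X\to(A\to X\to X)\to X$; $\mathsf{nilCL}=\Lambda A,X.\lambda c_N,c_C.\,c_N$; $\mathsf{consCL}=\Lambda A.\lambda x,xs.\Lambda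 X.\lambda c_N,c_C.\ c_C\ x\ (xs\cdot X\ c_N\ c_C)$; $\mathsf{ListP}\cdot A\ xsC=\forall X{:}\star.\forall P{:}X\to\star.\forall c_N{:}X.\forall c_C{:}A\to X\to X.\ P\ c_N\to(\forall xs{:}X.\Pi x{:}A.\ P\ xs\to P(c_C\ x\ xs))\to P(xsC\cdot X\ c_N\ c_C)$; $\mathsf{ListR}\cdot A\ xsC=(xsC\cdot(\mathsf{ListC}\cdot A)\ \mathsf{nilCL}\ \mathsf{consCL}\simeq xsC)$; $\mathsf{List}\cdot A=\iota xs{:}(\iota xsC{:}\mathsf{ListC}\cdot A.\ \mathsf{ListP}\cdot A\ xsC).\ \mathsf{ListR}\cdot A\ xs.1$. Helper: $\mathsf{mkList}=\Lambda A.\lambda xs.\Lambda q.\,[xs,\ \rho\ q-\beta\{xs\}]$ of type $\forall A.\Pi xs{:}(\iota xsC{:}\mathsf{ListC}\cdot A.\mathsf{ListP}\cdot A\ xsC).\ \mathsf{ListR}\cdot A\ xs.1\Rightarrow\mathsf{List}\cdot A$. With $\mathsf{nilL},\mathsf{consL}$ the constructors of $\mathsf{List}$, the eliminator $\mathsf{elimList}:\forall A.\Pi xs{:}\mathsf{List}\cdot A.\forall P{:}\mathsf{List}\cdot A\to\star.\ P(\mathsf{nilL}\cdot A)\to(\forall xs{:}\mathsf{List}\cdot A.\Pi x{:}A.\ P\ xs\to P(\mathsf{consL}\cdot A\ x\ xs))\to P\ xs$ is $\Lambda A.\lambda xs.\Lambda P.\ \rho\ (\varsigma\ xs.2)-(xs.1.2\cdot(\mathsf{List}\cdot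 A)\cdot P\ {-}(\mathsf{nilL}\cdot A)\ {-}(\mathsf{consL}\cdot A))$. $\mathsf{length}:\forall A{:}\star.\mathsf{List}\cdot A\to\mathsf{Nat}$ is the usual length function. **Vectors.** $\mathsf{Nat}$ is the type of naturals with $\mathsf{zero},\mathsf{suc}$ and multiplication $\mathsf{mult}$. $\mathsf{VecC}\cdot A\ n=\forall X{:}\mathsf{Nat}\to\star.\ X\ \mathsf{zero}\to(\forall n{:}\mathsf{Nat}.\ A\to X\ n\to X(\mathsf{suc}\ n))\to X\ n$; $\mathsf{nilCV}=\Lambda A,X.\lambda c_N,c_C.\,c_N$; $\mathsf{consCV}=\Lambda A,n.\lambda x,xs.\Lambda X.\lambda c_N,c_C.\ c_C\ {-}n\ x\ (xs\cdot X\ c_N\ c_C)$; $\mathsf{VecP}\cdot A\ n\ xsC=\forall X{:}\mathsf{Nat}\to\star.\forall P{:}\Pi n{:}\mathsf{Nat}.X\ n\to\star.\forall c_N{:}X\ \mathsf{zero}.\forall c_C{:}(\forall n{:}\mathsf{Nat}.A\to X\ n\to X(\mathsf{suc}\ n)).\ P\ \mathsf{zero}\ c_N\to(\forall n{:}\mathsf{Nat}.\forall xs{:}X\ n.\Pi x{:}A.\ P\ n\ xs\to P(\mathsf{suc}\ n)(c_C\ {-}n\ x\ xs))\to P\ n\ (xsC\cdot X\ c_N\ c_C)$; $\mathsf{VecR}\cdot A\ n\ xsC=(xsC\cdot(\mathsf{VecC}\cdot A)\ \mathsf{nilCV}\ \mathsf{consCV}\simeq xsC)$; $\mathsf{Vec}\cdot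 A\ n=\iota xs{:}(\iota xsC{:}\mathsf{VecC}\cdot A\ n.\ \mathsf{VecP}\cdot A\ n\ xsC).\ \mathsf{VecR}\cdot A\ n\ xs.1$. Helper: $\mathsf{mkVec}=\Lambda A.\Lambda n.\lambda xs.\Lambda q.\,[xs,\ \rho\ q-\beta\{xs\}]$ of type $\forall A.\forall n.\Pi xs{:}(\iota xsC{:}\mathsf{VecC}\cdot A\ n.\mathsf{VecP}\cdot A\ n\ xsC).\ \mathsf{VecR}\cdot A\ n\ xs.1\Rightarrow\mathsf{Vec}\cdot A\ n$. **Coercion $\mathsf{v2l}$** of type $\forall A.\forall n.\ \mathsf{Vec}\cdot A\ n\to\mathsf{List}\cdot A$. $\mathsf{v2lC}=\Lambda A.\Lambda n.\lambda xs.\Lambda X.\lambda c_N.\lambda c_C.\ xs.1.1\cdot(\lambda\_{:}\mathsf{Nat}.X)\ c_N\ (\Lambda\_.\,c_C)$; $\mathsf{v2lP}=\Lambda A.\Lambda n.\lambda xs.\Lambda X.\Lambda P.\Lambda c_N.\Lambda c_C.\lambda p_N.\lambda p_C.\ xs.1.2\cdot(\lambda\_{:}\mathsf{Nat}.X)\cdot(\lambda\_{:}\mathsf{Nat}.P)\ {-}c_N\ {-}(\Lambda\_.\,c_C)\ p_N\ (\Lambda\_.\,p_C)$; $\mathsf{v2lR}=\Lambda A.\Lambda n.\lambda xs.\ xs.2$; $\mathsf{v2l}=\Lambda A.\Lambda n.\lambda xs.\ \mathsf{mkList}\cdot A\ [\mathsf{v2lC}\cdot A\ {-}n\ xs,\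 \mathsf{v2lP}\cdot A\ {-}n\ xs]\ {-}(\mathsf{v2lR}\cdot A\ {-}n\ xs)$. **Coercion $\mathsf{l2v}$** of type $\forall A.\Pi xs{:}\mathsf{List}\cdot A.\ \mathsf{Vec}\cdot A\ (\mathsf{length}\cdot A\ xs)$. $\mathsf{l2vC}=\Lambda A.\lambda xs.\Lambda X.\lambda c_N.\lambda c_C.\ \mathsf{elimList}\cdot A\ xs\cdot(\lambda xs{:}\mathsf{List}\cdot A.\ X(\mathsf{length}\cdot A\ xs))\ c_N\ (\Lambda xs.\ c_C\ {-}(\mathsf{length}\cdot A\ xs))$; $\mathsf{l2vP}=\Lambda A.\lambda xs.\Lambda X.\Lambda P.\Lambda c_N.\Lambda c_C.\lambda p_N.\lambda p_C.\ \mathsf{elimList}\cdot A\ xs\cdot(\lambda xs{:}\mathsf{List}\cdot A.\ P(\mathsf{length}\cdot A\ xs)(\mathsf{l2vC}\cdot A\ xs\cdot X\ c_N\ c_C))\ p_N\ (\Lambda xs.\ p_C\ {-}(\mathsf{length}\cdot A\ xs)\ {-}(\mathsf{l2vC}\cdot A\ xs\cdot X\ c_N\ c_C))$; $\mathsf{l2vR}=\Lambda A.\lambda xs.\ xs.2$; $\mathsf{l2v}=\Lambda A.\lambda xs.\ \mathsf{mkVec}\cdot A\ {-}(\mathsf{length}\cdot A\ xs)\ [\mathsf{l2vC}\cdot A\ xs,\ \mathsf{l2vP}\cdot A\ xs]\ {-}(\mathsf{l2vR}\cdot A\ xs)$. **Length-constrained lists.** $\mathsf{VecL}\cdot A\ n=\iota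 xs{:}\mathsf{List}\cdot A.\ (n\simeq\mathsf{length}\cdot A\ xs)$. $\mathsf{mkVecL}=\Lambda A.\Lambda n.\lambda xs.\Lambda q.\,[xs,\ \rho\ q-\beta\{xs\}]$ of type $\forall A.\forall n.\Pi xs{:}\mathsf{List}\cdot A.\ (\mathsf{length}\cdot A\ xs\simeq n)\Rightarrow\mathsf{VecL}\cdot A\ n$. $\mathsf{lengthPres}$ is a proof of $\forall A.\forall n.\Pi xs{:}\mathsf{Vec}\cdot A\ n.\ n\simeq\mathsf{length}\cdot A\ (\mathsf{v2l}\cdot A\ {-}n\ xs)$. $\mathsf{v2u}:\forall A.\forall n.\ \mathsf{Vec}\cdot A\ n\to\mathsf{VecL}\cdot A\ n$ is $\Lambda A.\Lambda n.\lambda xs.\ \mathsf{mkVecL}\cdot A\ {-}n\ (\mathsf{v2l}\cdot A\ {-}n\ xs)\ {-}(\varsigma\ (\mathsf{lengthPres}\cdot A\ {-}n\ xs))$. $\mathsf{u2l}:\forall A.\forall n.\ \mathsf{VecL}\cdot A\ n\to\mathsf{List}\cdot A$ is $\Lambda A.\Lambda n.\lambda xs.\ xs.1$. **Map.** $\mathsf{mapCL}=\Lambda A.\Lambda B.\lambda f.\lambda xs.\Lambda X.\lambda c_N.\lambda c_C.\ xs.1.1\cdot X\ c_N\ (\lambda x.\ c_C\ (f\ x))$; $\mathsf{mapPL}=\Lambda A.\Lambda B.\lambda f.\lambda xs.\Lambda X.\Lambda P.\Lambda c_N.\Lambda c_C.\lambda p_N.\lambda p_C.\ xs.1.2\cdot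 X\cdot P\ {-}c_N\ {-}(\lambda x.\ c_C\ (f\ x))\ p_N\ (\Lambda xsC.\lambda x.\ p_C\ {-}xsC\ (f\ x))$; $\mathsf{mapRL}$ is a proof of $\forall A.\forall B.\Pi f{:}A\to B.\Pi xs{:}\mathsf{List}\cdot A.\ \mathsf{ListR}\cdot B\ (\mathsf{mapCL}\cdot A\cdot B\ f\ xs)$; $\mathsf{mapL}:\forall A.\forall B.\Pi f{:}A\to B.\ \mathsf{List}\cdot A\to\mathsf{List}\cdot B$ is $\Lambda A.\Lambda B.\lambda f.\lambda xs.\ \mathsf{mkList}\cdot B\ [\mathsf{mapCL}\cdot A\cdot B\ f\ xs,\ \mathsf{mapPL}\cdot A\cdot B\ f\ xs]\ {-}(\mathsf{mapRL}\cdot A\cdot B\ f\ xs)$. **Nested coercions.** $\mathsf{v2l\text{-}v2l}:\forall A.\forall n.\forall m.\ \mathsf{Vec}\cdot(\mathsf{Vec}\cdot A\ n)\ m\to\mathsf{List}\cdot(\mathsf{List}\cdot A)$ is $\Lambda A.\Lambda n.\Lambda m.\lambda xss.\ \mathsf{mapL}\cdot(\mathsf{Vec}\cdot A\ n)\cdot(\mathsf{List}\cdot A)\ (\mathsf{v2l}\cdot A\ {-}n)\ (\mathsf{v2l}\cdot(\mathsf{Vec}\cdot A\ n)\ {-}m\ xss)$. $\mathsf{v2u\text{-}v2l}:\forall A.\forall n.\forall m.\ \mathsf{Vec}\cdot(\mathsf{Vec}\cdot A\ n)\ m\to\mathsf{List}\cdot(\mathsf{VecL}\cdot A\ n)$ is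 $\Lambda A.\Lambda n.\Lambda m.\lambda xss.\ \mathsf{mapL}\cdot(\mathsf{Vec}\cdot A\ n)\cdot(\mathsf{VecL}\cdot A\ n)\ (\mathsf{v2u}\cdot A\ {-}n)\ (\mathsf{v2l}\cdot(\mathsf{Vec}\cdot A\ n)\ {-}m\ xss)$. $\mathsf{u2l\text{-}l2l}:\forall A.\forall n.\ \mathsf{List}\cdot(\mathsf{VecL}\cdot A\ n)\to\mathsf{List}\cdot(\mathsf{List}\cdot A)$ is $\Lambda A.\Lambda n.\lambda xss.\ \mathsf{mapL}\cdot(\mathsf{VecL}\cdot A\ n)\cdot(\mathsf{List}\cdot A)\ (\mathsf{u2l}\cdot A\ {-}n)\ xss$. *)

theory Defs
  imports Main
begin

text \<open>
  Cedille in locally nameless style. Variables are either free (a name) or bound (a de Bruijn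
  index), so that alpha-equivalence is equality. Terms are always written with names: a named
  binder replaces the free occurrences of its name by the new index. Term variables and type
  variables share one space of names and indices.
\<close>

type_synonym name = string

datatype var = Fr name | Bd nat

datatype
  tm = Var var
     | Lam tm
     | App tm tm
     | ILam tm
     | IApp tm tm  (infixl "\<ominus>" 90)
     | TApp tm tp  (infixl "\<cdot>" 90)
     | DPair tm tm  ("\<langle>_,/ _\<rangle>")
     | Prj1 tm  ("_\<^bold>.1" [100] 100)
     | Prj2 tm  ("_\<^bold>.2" [100] 100)
     | Beta  ("\<beta>")
     | BetaW tm  ("\<beta>\<lbrace>_\<rbrace>")
     | Rho tm tm  ("\<rho> _ \<^bold>-/ _" [100, 10] 10)
     | Sym tm  ("\<sigma> _" [100] 99)
and
  tp = TVar var
     | Pi tp tp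
     | Forall tp tp
     | ForallT kd tp
     | Iota tp tp
     | TLam tp tp
     | TLamT kd tp
     | TAppV tp tm  (infixl "\<^bold>\<bullet>" 90)
     | TAppT tp tp  (infixl "\<^bold>\<cdot>" 90)
     | EqT tm tm  (infix "\<simeq>" 60)
and
  kd = Star  ("\<star>")
     | KPi tp kd
     | KPiT kd kd

notation App  (infixl "\<bullet>" 90)

abbreviation fvar :: "name \<Rightarrow> tm"  ("$_" [1000] 1000) where "$x \<equiv> Var (Fr x)"
abbreviation ftvar :: "name \<Rightarrow> tp"  ("$$_" [1000] 1000) where "$$X \<equiv> TVar (Fr X)"


subsection \<open>Binding, instantiation, local closure\<close>

primrec bind_var :: "nat \<Rightarrow> name \<Rightarrow> var \<Rightarrow> var" where
  "bind_var k x (Fr y) = (if y = x then Bd k else Fr y)"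
| "bind_var k x (Bd i) = Bd i"

primrec bind_tm :: "nat \<Rightarrow> name \<Rightarrow> tm \<Rightarrow> tm"
    and bind_tp :: "nat \<Rightarrow> name \<Rightarrow> tp \<Rightarrow> tp"
    and bind_kd :: "nat \<Rightarrow> name \<Rightarrow> kd \<Rightarrow> kd" where
  "bind_tm k x (Var v) = Var (bind_var k x v)"
| "bind_tm k x (Lam t) = Lam (bind_tm (Suc k) x t)"
| "bind_tm k x (App t u) = App (bind_tm k x t) (bind_tm k x u)"
| "bind_tm k x (ILam t) = ILam (bind_tm (Suc k) x t)"
| "bind_tm k x (IApp t u) = IApp (bind_tm k x t) (bind_tm k x u)"
| "bind_tm k x (TApp t T) = TApp (bind_tm k x t) (bind_tp k x T)"
| "bind_tm k x (DPair t u) = DPair (bind_tm k x t) (bind_tm k x u)"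
| "bind_tm k x (Prj1 t) = Prj1 (bind_tm k x t)"
| "bind_tm k x (Prj2 t) = Prj2 (bind_tm k x t)"
| "bind_tm k x Beta = Beta"
| "bind_tm k x (BetaW t) = BetaW (bind_tm k x t)"
| "bind_tm k x (Rho q t) = Rho (bind_tm k x q) (bind_tm k x t)"
| "bind_tm k x (Sym q) = Sym (bind_tm k x q)"
| "bind_tp k x (TVar v) = TVar (bind_var k x v)"
| "bind_tp k x (Pi S T) = Pi (bind_tp k x S) (bind_tp (Suc k) x T)"
| "bind_tp k x (Forall S T) = Forall (bind_tp k x S) (bind_tp (Suc k) x T)"
| "bind_tp k x (ForallT K T) = ForallT (bind_kd k x K) (bind_tp (Suc k) x T)"
| "bind_tp k x (Iota S T) = Iota (bind_tp k x S) (bind_tp (Suc k) x T)"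
| "bind_tp k x (TLam S T) = TLam (bind_tp k x S) (bind_tp (Suc k) x T)"
| "bind_tp k x (TLamT K T) = TLamT (bind_kd k x K) (bind_tp (Suc k) x T)"
| "bind_tp k x (TAppV T t) = TAppV (bind_tp k x T) (bind_tm k x t)"
| "bind_tp k x (TAppT T S) = TAppT (bind_tp k x T) (bind_tp k x S)"
| "bind_tp k x (EqT t u) = EqT (bind_tm k x t) (bind_tm k x u)"
| "bind_kd k x Star = Star"
| "bind_kd k x (KPi T K) = KPi (bind_tp k x T) (bind_kd (Suc k) x K)"
| "bind_kd k x (KPiT K L) = KPiT (bind_kd k x K) (bind_kd (Suc k) x L)"

datatype arg = TmArg tm | TpArg tp

primrec inst_tm :: "nat \<Rightarrow> arg \<Rightarrow> tm \<Rightarrow> tm"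
    and inst_tp :: "nat \<Rightarrow> arg \<Rightarrow> tp \<Rightarrow> tp"
    and inst_kd :: "nat \<Rightarrow> arg \<Rightarrow> kd \<Rightarrow> kd" where
  "inst_tm k a (Var v) =
     (case a of TmArg u \<Rightarrow> if v = Bd k then u else Var v | TpArg _ \<Rightarrow> Var v)"
| "inst_tm k a (Lam t) = Lam (inst_tm (Suc k) a t)"
| "inst_tm k a (App t u) = App (inst_tm k a t) (inst_tm k a u)"
| "inst_tm k a (ILam t) = ILam (inst_tm (Suc k) a t)"
| "inst_tm k a (IApp t u) = IApp (inst_tm k a t) (inst_tm k a u)"
| "inst_tm k a (TApp t T) = TApp (inst_tm k a t) (inst_tp k a T)"
| "inst_tm k a (DPair t u) = DPair (inst_tm k a t) (inst_tm k a u)"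
| "inst_tm k a (Prj1 t) = Prj1 (inst_tm k a t)"
| "inst_tm k a (Prj2 t) = Prj2 (inst_tm k a t)"
| "inst_tm k a Beta = Beta"
| "inst_tm k a (BetaW t) = BetaW (inst_tm k a t)"
| "inst_tm k a (Rho q t) = Rho (inst_tm k a q) (inst_tm k a t)"
| "inst_tm k a (Sym q) = Sym (inst_tm k a q)"
| "inst_tp k a (TVar v) =
     (case a of TpArg U \<Rightarrow> if v = Bd k then U else TVar v | TmArg _ \<Rightarrow> TVar v)"
| "inst_tp k a (Pi S T) = Pi (inst_tp k a S) (inst_tp (Suc k) a T)"
| "inst_tp k a (Forall S T) = Forall (inst_tp k a S) (inst_tp (Suc k) a T)"
| "inst_tp k a (ForallT K T) = ForallT (inst_kd k a K) (inst_tp (Suc k) a T)"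
| "inst_tp k a (Iota S T) = Iota (inst_tp k a S) (inst_tp (Suc k) a T)"
| "inst_tp k a (TLam S T) = TLam (inst_tp k a S) (inst_tp (Suc k) a T)"
| "inst_tp k a (TLamT K T) = TLamT (inst_kd k a K) (inst_tp (Suc k) a T)"
| "inst_tp k a (TAppV T t) = TAppV (inst_tp k a T) (inst_tm k a t)"
| "inst_tp k a (TAppT T S) = TAppT (inst_tp k a T) (inst_tp k a S)"
| "inst_tp k a (EqT t u) = EqT (inst_tm k a t) (inst_tm k a u)"
| "inst_kd k a Star = Star"
| "inst_kd k a (KPi T K) = KPi (inst_tp k a T) (inst_kd (Suc k) a K)"
| "inst_kd k a (KPiT K L) = KPiT (inst_kd k a K) (inst_kd (Suc k) a L)"

text \<open>Forall indices point to a binder, where \<open>k\<close> enclosing binders are still to come.\<close>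

primrec lc_var :: "nat \<Rightarrow> var \<Rightarrow> bool" where
  "lc_var k (Fr x) = True"
| "lc_var k (Bd i) = (i < k)"

primrec lc_tm :: "nat \<Rightarrow> tm \<Rightarrow> bool"
    and lc_tp :: "nat \<Rightarrow> tp \<Rightarrow> bool"
    and lc_kd :: "nat \<Rightarrow> kd \<Rightarrow> bool" where
  "lc_tm k (Var v) = lc_var k v"
| "lc_tm k (Lam t) = lc_tm (Suc k) t"
| "lc_tm k (App t u) = (lc_tm k t \<and> lc_tm k u)"
| "lc_tm k (ILam t) = lc_tm (Suc k) t"
| "lc_tm k (IApp t u) = (lc_tm k t \<and> lc_tm k u)"
| "lc_tm k (TApp t T) = (lc_tm k t \<and> lc_tp k T)"
| "lc_tm k (DPair t u) = (lc_tm k t \<and> lc_tm k u)"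
| "lc_tm k (Prj1 t) = lc_tm k t"
| "lc_tm k (Prj2 t) = lc_tm k t"
| "lc_tm k Beta = True"
| "lc_tm k (BetaW t) = lc_tm k t"
| "lc_tm k (Rho q t) = (lc_tm k q \<and> lc_tm k t)"
| "lc_tm k (Sym q) = lc_tm k q"
| "lc_tp k (TVar v) = lc_var k v"
| "lc_tp k (Pi S T) = (lc_tp k S \<and> lc_tp (Suc k) T)"
| "lc_tp k (Forall S T) = (lc_tp k S \<and> lc_tp (Suc k) T)"
| "lc_tp k (ForallT K T) = (lc_kd k K \<and> lc_tp (Suc k) T)"
| "lc_tp k (Iota S T) = (lc_tp k S \<and> lc_tp (Suc k) T)"
| "lc_tp k (TLam S T) = (lc_tp k S \<and> lc_tp (Suc k) T)"
| "lc_tp k (TLamT K T) = (lc_kd k K \<and> lc_tp (Suc k) T)"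
| "lc_tp k (TAppV T t) = (lc_tp k T \<and> lc_tm k t)"
| "lc_tp k (TAppT T S) = (lc_tp k T \<and> lc_tp k S)"
| "lc_tp k (EqT t u) = (lc_tm k t \<and> lc_tm k u)"
| "lc_kd k Star = True"
| "lc_kd k (KPi T K) = (lc_tp k T \<and> lc_kd (Suc k) K)"
| "lc_kd k (KPiT K L) = (lc_kd k K \<and> lc_kd (Suc k) L)"


subsection \<open>Named binders\<close>

definition lam :: "name \<Rightarrow> tm \<Rightarrow> tm"  ("\<^bold>\<lambda>_./ _" [1000, 10] 10)
  where "(\<^bold>\<lambda>x. t) = Lam (bind_tm 0 x t)"

definition ilam :: "name \<Rightarrow> tm \<Rightarrow> tm"  ("\<^bold>\<Lambda>_./ _" [1000, 10] 10)
  where "(\<^bold>\<Lambda>x. t) = ILam (bind_tm 0 x t)"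

definition pi_tp :: "name \<Rightarrow> tp \<Rightarrow> tp \<Rightarrow> tp"  ("\<^bold>\<Pi>_:_./ _" [1000, 11, 10] 10)
  where "(\<^bold>\<Pi>x:S. T) = Pi S (bind_tp 0 x T)"

definition forall_tp :: "name \<Rightarrow> tp \<Rightarrow> tp \<Rightarrow> tp"  ("\<^bold>\<forall>_:_./ _" [1000, 11, 10] 10)
  where "(\<^bold>\<forall>x:S. T) = Forall S (bind_tp 0 x T)"

definition forallt_tp :: "name \<Rightarrow> kd \<Rightarrow> tp \<Rightarrow> tp"  ("\<^bold>\<forall>_\<Colon>_./ _" [1000, 11, 10] 10)
  where "(\<^bold>\<forall>X\<Colon>K. T) = ForallT K (bind_tp 0 X T)"

definition iota_tp :: "name \<Rightarrow> tp \<Rightarrow> tp \<Rightarrow> tp"  ("\<^bold>\<iota>_:_./ _" [1000, 11, 10] 10)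
  where "(\<^bold>\<iota>x:S. T) = Iota S (bind_tp 0 x T)"

definition tlam :: "name \<Rightarrow> tp \<Rightarrow> tp \<Rightarrow> tp"  ("\<^bold>\<lambda>_:_./ _" [1000, 11, 10] 10)
  where "(\<^bold>\<lambda>x:S. T) = TLam S (bind_tp 0 x T)"

definition tlamt :: "name \<Rightarrow> kd \<Rightarrow> tp \<Rightarrow> tp"  ("\<^bold>\<lambda>_\<Colon>_./ _" [1000, 11, 10] 10)
  where "(\<^bold>\<lambda>X\<Colon>K. T) = TLamT K (bind_tp 0 X T)"

definition kpi :: "name \<Rightarrow> tp \<Rightarrow> kd \<Rightarrow> kd"  ("\<^bold>\<Pi>\<^sub>\<kappa>_:_./ _" [1000, 11, 10] 10)
  where "(\<^bold>\<Pi>\<^sub>\<kappa>x:S. K) = KPi S (bind_kd 0 x K)"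

definition kpit :: "name \<Rightarrow> kd \<Rightarrow> kd \<Rightarrow> kd"  ("\<^bold>\<Pi>\<^sub>\<kappa>_\<Colon>_./ _" [1000, 11, 10] 10)
  where "(\<^bold>\<Pi>\<^sub>\<kappa>X\<Colon>K. L) = KPiT K (bind_kd 0 X L)"

text \<open>The non-dependent forms need no shifting, as their bodies are locally closed.\<close>

abbreviation arr :: "tp \<Rightarrow> tp \<Rightarrow> tp"  (infixr "\<^bold>\<rightarrow>" 50) where "S \<^bold>\<rightarrow> T \<equiv> Pi S T"
abbreviation iarr :: "tp \<Rightarrow> tp \<Rightarrow> tp"  (infixr "\<^bold>\<Rightarrow>" 50) where "S \<^bold>\<Rightarrow> T \<equiv> Forall S T"
abbreviation karr :: "tp \<Rightarrow> kd \<Rightarrow> kd"  (infixr "\<^bold>\<rightarrow>\<^sub>\<kappa>" 50) where "S \<^bold>\<rightarrow>\<^sub>\<kappa> K \<equiv> KPi S K"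


subsection \<open>Untyped lambda-terms and beta-eta-equality\<close>

datatype utm = UVar var | ULam utm | UApp utm utm

primrec bind_u :: "nat \<Rightarrow> name \<Rightarrow> utm \<Rightarrow> utm" where
  "bind_u k x (UVar v) = UVar (bind_var k x v)"
| "bind_u k x (ULam t) = ULam (bind_u (Suc k) x t)"
| "bind_u k x (UApp t u) = UApp (bind_u k x t) (bind_u k x u)"

primrec inst_u :: "nat \<Rightarrow> utm \<Rightarrow> utm \<Rightarrow> utm" where
  "inst_u k s (UVar v) = (if v = Bd k then s else UVar v)"
| "inst_u k s (ULam t) = ULam (inst_u (Suc k) s t)"
| "inst_u k s (UApp t u) = UApp (inst_u k s t) (inst_u k s u)"

primrec lc_u :: "nat \<Rightarrow> utm \<Rightarrow> bool" where
  "lc_u k (UVar v) = lc_var k v"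
| "lc_u k (ULam t) = lc_u (Suc k) t"
| "lc_u k (UApp t u) = (lc_u k t \<and> lc_u k u)"

primrec fv_u :: "utm \<Rightarrow> name set" where
  "fv_u (UVar v) = (case v of Fr x \<Rightarrow> {x} | Bd _ \<Rightarrow> {})"
| "fv_u (ULam t) = fv_u t"
| "fv_u (UApp t u) = fv_u t \<union> fv_u u"

definition ulam :: "name \<Rightarrow> utm \<Rightarrow> utm" where
  "ulam x t = ULam (bind_u 0 x t)"

inductive beta_eta_eq :: "utm \<Rightarrow> utm \<Rightarrow> bool"  (infix "=\<^sub>\<beta>\<^sub>\<eta>" 50) where
  be_refl: "t =\<^sub>\<beta>\<^sub>\<eta> t"
| be_sym: "t =\<^sub>\<beta>\<^sub>\<eta> u \<Longrightarrow> u =\<^sub>\<beta>\<^sub>\<eta> t"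
| be_trans: "t =\<^sub>\<beta>\<^sub>\<eta> u \<Longrightarrow> u =\<^sub>\<beta>\<^sub>\<eta> s \<Longrightarrow> t =\<^sub>\<beta>\<^sub>\<eta> s"
| be_app: "t =\<^sub>\<beta>\<^sub>\<eta> t' \<Longrightarrow> u =\<^sub>\<beta>\<^sub>\<eta> u' \<Longrightarrow> UApp t u =\<^sub>\<beta>\<^sub>\<eta> UApp t' u'"
| be_lam: "t =\<^sub>\<beta>\<^sub>\<eta> t' \<Longrightarrow> ulam x t =\<^sub>\<beta>\<^sub>\<eta> ulam x t'"
| be_beta: "lc_u 0 (ULam t) \<Longrightarrow> lc_u 0 u \<Longrightarrow> UApp (ULam t) u =\<^sub>\<beta>\<^sub>\<eta> inst_u 0 u t"
| be_eta: "lc_u 0 t \<Longrightarrow> ULam (UApp t (UVar (Bd 0))) =\<^sub>\<beta>\<^sub>\<eta> t"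


subsection \<open>Erasure\<close>

text \<open>
  Erasing \<open>\<Lambda>x. t\<close> to the erasure of \<open>t\<close> removes a binder, so the indices that point beyond
  it go down by one. The typing rule for \<open>\<Lambda>\<close> demands that \<open>x\<close> is not free in the erasure of
  \<open>t\<close>; only if this is violated does the removed index occur, and it is then filled by an
  arbitrary closed term to keep the function total.
\<close>

primrec drop_u :: "nat \<Rightarrow> utm \<Rightarrow> utm" where
  "drop_u k (UVar v) = (case v of Fr x \<Rightarrow> UVar (Fr x)
     | Bd i \<Rightarrow> if i < k then UVar (Bd i) else if i = k then ULam (UVar (Bd 0)) else UVar (Bd (i - 1)))"
| "drop_u k (ULam t) = ULam (drop_u (Suc k) t)"
| "drop_u k (UApp t u) = UApp (drop_u k t) (drop_u k u)"

primrec erase :: "tm \<Rightarrow> utm"  ("|_|") where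
  "|Var v| = UVar v"
| "|Lam t| = ULam |t|"
| "|App t u| = UApp |t| |u|"
| "|ILam t| = drop_u 0 |t|"
| "|t \<ominus> u| = |t|"
| "|t \<cdot> T| = |t|"
| "|\<langle>t, u\<rangle>| = |t|"
| "|t\<^bold>.1| = |t|"
| "|t\<^bold>.2| = |t|"
| "|\<beta>| = ULam (UVar (Bd 0))"
| "|\<beta>\<lbrace>t\<rbrace>| = |t|"
| "|\<rho> q \<^bold>- t| = |t|"
| "|\<sigma> q| = |q|"


subsection \<open>Conversion of types and kinds\<close>

text \<open>Terms inside types are compared by their erasures.\<close>

inductive conv_tp :: "tp \<Rightarrow> tp \<Rightarrow> bool"  (infix "\<cong>" 50)
      and conv_kd :: "kd \<Rightarrow> kd \<Rightarrow> bool"  (infix "\<cong>\<^sub>\<kappa>" 50) where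
  cv_refl: "T \<cong> T"
| cv_sym: "S \<cong> T \<Longrightarrow> T \<cong> S"
| cv_trans: "S \<cong> T \<Longrightarrow> T \<cong> U \<Longrightarrow> S \<cong> U"
| cv_beta: "lc_tp 0 (TLam S T) \<Longrightarrow> lc_tm 0 t \<Longrightarrow> TLam S T \<^bold>\<bullet> t \<cong> inst_tp 0 (TmArg t) T"
| cv_betaT: "lc_tp 0 (TLamT K T) \<Longrightarrow> lc_tp 0 S \<Longrightarrow> TLamT K T \<^bold>\<cdot> S \<cong> inst_tp 0 (TpArg S) T"
| cv_pi: "S \<cong> S' \<Longrightarrow> T \<cong> T' \<Longrightarrow> (\<^bold>\<Pi>x:S. T) \<cong> (\<^bold>\<Pi>x:S'. T')"
| cv_all: "S \<cong> S' \<Longrightarrow> T \<cong> T' \<Longrightarrow> (\<^bold>\<forall>x:S. T) \<cong> (\<^bold>\<forall>x:S'. T')"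
| cv_allT: "K \<cong>\<^sub>\<kappa> K' \<Longrightarrow> T \<cong> T' \<Longrightarrow> (\<^bold>\<forall>X\<Colon>K. T) \<cong> (\<^bold>\<forall>X\<Colon>K'. T')"
| cv_iota: "S \<cong> S' \<Longrightarrow> T \<cong> T' \<Longrightarrow> (\<^bold>\<iota>x:S. T) \<cong> (\<^bold>\<iota>x:S'. T')"
| cv_tlam: "S \<cong> S' \<Longrightarrow> T \<cong> T' \<Longrightarrow> (\<^bold>\<lambda>x:S. T) \<cong> (\<^bold>\<lambda>x:S'. T')"
| cv_tlamT: "K \<cong>\<^sub>\<kappa> K' \<Longrightarrow> T \<cong> T' \<Longrightarrow> (\<^bold>\<lambda>X\<Colon>K. T) \<cong> (\<^bold>\<lambda>X\<Colon>K'. T')"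
| cv_app: "T \<cong> T' \<Longrightarrow> |t| =\<^sub>\<beta>\<^sub>\<eta> |t'| \<Longrightarrow> T \<^bold>\<bullet> t \<cong> T' \<^bold>\<bullet> t'"
| cv_appT: "T \<cong> T' \<Longrightarrow> S \<cong> S' \<Longrightarrow> T \<^bold>\<cdot> S \<cong> T' \<^bold>\<cdot> S'"
| cv_eq: "|t| =\<^sub>\<beta>\<^sub>\<eta> |t'| \<Longrightarrow> |u| =\<^sub>\<beta>\<^sub>\<eta> |u'| \<Longrightarrow> (t \<simeq> u) \<cong> (t' \<simeq> u')"
| ck_refl: "K \<cong>\<^sub>\<kappa> K"
| ck_sym: "K \<cong>\<^sub>\<kappa> L \<Longrightarrow> L \<cong>\<^sub>\<kappa> K"
| ck_trans: "K \<cong>\<^sub>\<kappa> L \<Longrightarrow> L \<cong>\<^sub>\<kappa> M \<Longrightarrow> K \<cong>\<^sub>\<kappa> M"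
| ck_pi: "S \<cong> S' \<Longrightarrow> K \<cong>\<^sub>\<kappa> K' \<Longrightarrow> (\<^bold>\<Pi>\<^sub>\<kappa>x:S. K) \<cong>\<^sub>\<kappa> (\<^bold>\<Pi>\<^sub>\<kappa>x:S'. K')"
| ck_piT: "L \<cong>\<^sub>\<kappa> L' \<Longrightarrow> K \<cong>\<^sub>\<kappa> K' \<Longrightarrow> (\<^bold>\<Pi>\<^sub>\<kappa>X\<Colon>L. K) \<cong>\<^sub>\<kappa> (\<^bold>\<Pi>\<^sub>\<kappa>X\<Colon>L'. K')"


subsection \<open>Typing\<close>

datatype decl = TmD tp | TpD kd

type_synonym ctx = "(name \<times> decl) list"

definition tmvars :: "ctx \<Rightarrow> name set" where
  "tmvars \<Gamma> = {x. \<exists>T. (x, TmD T) \<in> set \<Gamma>}"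

text \<open>
  The declarative (Curry-style) rules. Named binders in the conclusions bind the most recently
  declared variable, so side conditions on freshness are all in \<open>wf_ctx\<close>. In the rule for
  \<open>\<rho> q - t\<close> the motive \<open>T\<close> is a type with index 0 as its hole: the equation is used to rewrite
  the expected type from left to right. As in Cedille, the term in \<open>\<beta>\<lbrace>u\<rbrace>\<close> need not be typed,
  only its erasure must be well scoped.
\<close>

inductive wf_ctx :: "ctx \<Rightarrow> bool"
      and okkind :: "ctx \<Rightarrow> kd \<Rightarrow> bool"  ("_ \<turnstile>\<^sub>\<kappa> _" [51, 51] 50)
      and kinding :: "ctx \<Rightarrow> tp \<Rightarrow> kd \<Rightarrow> bool"  ("_ \<turnstile>\<^sub>\<tau> _ \<^bold>: _" [51, 11, 11] 50)
      and typing :: "ctx \<Rightarrow> tm \<Rightarrow> tp \<Rightarrow> bool"  ("_ \<turnstile> _ \<^bold>: _" [51, 11, 11] 50) where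
  wf_nil: "wf_ctx []"
| wf_tm: "wf_ctx \<Gamma> \<Longrightarrow> x \<notin> fst ` set \<Gamma> \<Longrightarrow> \<Gamma> \<turnstile>\<^sub>\<tau> T \<^bold>: \<star> \<Longrightarrow> wf_ctx ((x, TmD T) # \<Gamma>)"
| wf_tp: "wf_ctx \<Gamma> \<Longrightarrow> X \<notin> fst ` set \<Gamma> \<Longrightarrow> \<Gamma> \<turnstile>\<^sub>\<kappa> K \<Longrightarrow> wf_ctx ((X, TpD K) # \<Gamma>)"

| k_star: "wf_ctx \<Gamma> \<Longrightarrow> \<Gamma> \<turnstile>\<^sub>\<kappa> \<star>"
| k_pi: "(x, TmD T) # \<Gamma> \<turnstile>\<^sub>\<kappa> K \<Longrightarrow> \<Gamma> \<turnstile>\<^sub>\<kappa> (\<^bold>\<Pi>\<^sub>\<kappa>x:T. K)"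
| k_piT: "(X, TpD L) # \<Gamma> \<turnstile>\<^sub>\<kappa> K \<Longrightarrow> \<Gamma> \<turnstile>\<^sub>\<kappa> (\<^bold>\<Pi>\<^sub>\<kappa>X\<Colon>L. K)"

| tp_var: "wf_ctx \<Gamma> \<Longrightarrow> (X, TpD K) \<in> set \<Gamma> \<Longrightarrow> \<Gamma> \<turnstile>\<^sub>\<tau> $$X \<^bold>: K"
| tp_pi: "(x, TmD S) # \<Gamma> \<turnstile>\<^sub>\<tau> T \<^bold>: \<star> \<Longrightarrow> \<Gamma> \<turnstile>\<^sub>\<tau> (\<^bold>\<Pi>x:S. T) \<^bold>: \<star>"
| tp_all: "(x, TmD S) # \<Gamma> \<turnstile>\<^sub>\<tau> T \<^bold>: \<star> \<Longrightarrow> \<Gamma> \<turnstile>\<^sub>\<tau> (\<^bold>\<forall>x:S. T) \<^bold>: \<star>"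
| tp_allT: "(X, TpD K) # \<Gamma> \<turnstile>\<^sub>\<tau> T \<^bold>: \<star> \<Longrightarrow> \<Gamma> \<turnstile>\<^sub>\<tau> (\<^bold>\<forall>X\<Colon>K. T) \<^bold>: \<star>"
| tp_iota: "(x, TmD S) # \<Gamma> \<turnstile>\<^sub>\<tau> T \<^bold>: \<star> \<Longrightarrow> \<Gamma> \<turnstile>\<^sub>\<tau> (\<^bold>\<iota>x:S. T) \<^bold>: \<star>"
| tp_lam: "(x, TmD S) # \<Gamma> \<turnstile>\<^sub>\<tau> T \<^bold>: K \<Longrightarrow> \<Gamma> \<turnstile>\<^sub>\<tau> (\<^bold>\<lambda>x:S. T) \<^bold>: (\<^bold>\<Pi>\<^sub>\<kappa>x:S. K)"
| tp_lamT: "(X, TpD L) # \<Gamma> \<turnstile>\<^sub>\<tau> T \<^bold>: K \<Longrightarrow> \<Gamma> \<turnstile>\<^sub>\<tau> (\<^bold>\<lambda>X\<Colon>L. T) \<^bold>: (\<^bold>\<Pi>\<^sub>\<kappa>X\<Colon>L. K)"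
| tp_app: "\<Gamma> \<turnstile>\<^sub>\<tau> T \<^bold>: KPi S K \<Longrightarrow> \<Gamma> \<turnstile> t \<^bold>: S \<Longrightarrow> \<Gamma> \<turnstile>\<^sub>\<tau> T \<^bold>\<bullet> t \<^bold>: inst_kd 0 (TmArg t) K"
| tp_appT: "\<Gamma> \<turnstile>\<^sub>\<tau> T \<^bold>: KPiT L K \<Longrightarrow> \<Gamma> \<turnstile>\<^sub>\<tau> S \<^bold>: L \<Longrightarrow> \<Gamma> \<turnstile>\<^sub>\<tau> T \<^bold>\<cdot> S \<^bold>: inst_kd 0 (TpArg S) K"
| tp_eq: "\<Gamma> \<turnstile> t \<^bold>: S \<Longrightarrow> \<Gamma> \<turnstile> u \<^bold>: T \<Longrightarrow> \<Gamma> \<turnstile>\<^sub>\<tau> t \<simeq> u \<^bold>: \<star>"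
| tp_conv: "\<Gamma> \<turnstile>\<^sub>\<tau> T \<^bold>: K \<Longrightarrow> K \<cong>\<^sub>\<kappa> L \<Longrightarrow> \<Gamma> \<turnstile>\<^sub>\<kappa> L \<Longrightarrow> \<Gamma> \<turnstile>\<^sub>\<tau> T \<^bold>: L"

| tm_var: "wf_ctx \<Gamma> \<Longrightarrow> (x, TmD T) \<in> set \<Gamma> \<Longrightarrow> \<Gamma> \<turnstile> $x \<^bold>: T"
| tm_lam: "(x, TmD S) # \<Gamma> \<turnstile> t \<^bold>: T \<Longrightarrow> \<Gamma> \<turnstile> (\<^bold>\<lambda>x. t) \<^bold>: (\<^bold>\<Pi>x:S. T)"
| tm_app: "\<Gamma> \<turnstile> t \<^bold>: Pi S T \<Longrightarrow> \<Gamma> \<turnstile> u \<^bold>: S \<Longrightarrow> \<Gamma> \<turnstile> t \<bullet> u \<^bold>: inst_tp 0 (TmArg u) T"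
| tm_ilam: "(x, TmD S) # \<Gamma> \<turnstile> t \<^bold>: T \<Longrightarrow> x \<notin> fv_u |t| \<Longrightarrow> \<Gamma> \<turnstile> (\<^bold>\<Lambda>x. t) \<^bold>: (\<^bold>\<forall>x:S. T)"
| tm_iapp: "\<Gamma> \<turnstile> t \<^bold>: Forall S T \<Longrightarrow> \<Gamma> \<turnstile> u \<^bold>: S \<Longrightarrow> \<Gamma> \<turnstile> t \<ominus> u \<^bold>: inst_tp 0 (TmArg u) T"
| tm_tlam: "(X, TpD K) # \<Gamma> \<turnstile> t \<^bold>: T \<Longrightarrow> \<Gamma> \<turnstile> (\<^bold>\<Lambda>X. t) \<^bold>: (\<^bold>\<forall>X\<Colon>K. T)"
| tm_tapp: "\<Gamma> \<turnstile> t \<^bold>: ForallT K T \<Longrightarrow> \<Gamma> \<turnstile>\<^sub>\<tau> S \<^bold>: K \<Longrightarrow> \<Gamma> \<turnstile> t \<cdot> S \<^bold>: inst_tp 0 (TpArg S) T"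
| tm_pair: "\<Gamma> \<turnstile>\<^sub>\<tau> Iota S T \<^bold>: \<star> \<Longrightarrow> \<Gamma> \<turnstile> t \<^bold>: S \<Longrightarrow> \<Gamma> \<turnstile> u \<^bold>: inst_tp 0 (TmArg t) T \<Longrightarrow>
    |t| =\<^sub>\<beta>\<^sub>\<eta> |u| \<Longrightarrow> \<Gamma> \<turnstile> \<langle>t, u\<rangle> \<^bold>: Iota S T"
| tm_prj1: "\<Gamma> \<turnstile> t \<^bold>: Iota S T \<Longrightarrow> \<Gamma> \<turnstile> t\<^bold>.1 \<^bold>: S"
| tm_prj2: "\<Gamma> \<turnstile> t \<^bold>: Iota S T \<Longrightarrow> \<Gamma> \<turnstile> t\<^bold>.2 \<^bold>: inst_tp 0 (TmArg (t\<^bold>.1)) T"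
| tm_beta: "\<Gamma> \<turnstile> t \<^bold>: T \<Longrightarrow> \<Gamma> \<turnstile> \<beta> \<^bold>: t \<simeq> t"
| tm_betaW: "\<Gamma> \<turnstile> t \<^bold>: T \<Longrightarrow> lc_tm 0 u \<Longrightarrow> fv_u |u| \<subseteq> tmvars \<Gamma> \<Longrightarrow> \<Gamma> \<turnstile> \<beta>\<lbrace>u\<rbrace> \<^bold>: t \<simeq> t"
| tm_sym: "\<Gamma> \<turnstile> q \<^bold>: t \<simeq> u \<Longrightarrow> \<Gamma> \<turnstile> \<sigma> q \<^bold>: u \<simeq> t"
| tm_rho: "\<Gamma> \<turnstile> q \<^bold>: t \<simeq> u \<Longrightarrow> \<Gamma> \<turnstile> s \<^bold>: inst_tp 0 (TmArg u) T \<Longrightarrow>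
    \<Gamma> \<turnstile>\<^sub>\<tau> inst_tp 0 (TmArg t) T \<^bold>: \<star> \<Longrightarrow> \<Gamma> \<turnstile> (\<rho> q \<^bold>- s) \<^bold>: inst_tp 0 (TmArg t) T"
| tm_conv: "\<Gamma> \<turnstile> t \<^bold>: S \<Longrightarrow> S \<cong> T \<Longrightarrow> \<Gamma> \<turnstile>\<^sub>\<tau> T \<^bold>: \<star> \<Longrightarrow> \<Gamma> \<turnstile> t \<^bold>: T"


subsection \<open>Natural numbers\<close>

text \<open>
  Naturals are derived like lists: as Church numerals, intersected with a proof of their induction
  principle and a proof of reflection (folding with the constructors is the identity).
\<close>

definition NatC :: tp where
  "NatC = (\<^bold>\<forall>''X''\<Colon>\<star>. $$''X'' \<^bold>\<rightarrow> ($$''X'' \<^bold>\<rightarrow> $$''X'') \<^bold>\<rightarrow> $$''X'')"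

definition zeroCN :: tm where
  "zeroCN = (\<^bold>\<Lambda>''X''. \<^bold>\<lambda>''cZ''. \<^bold>\<lambda>''cS''. $''cZ'')"

definition sucCN :: tm where
  "sucCN = (\<^bold>\<lambda>''n''. \<^bold>\<Lambda>''X''. \<^bold>\<lambda>''cZ''. \<^bold>\<lambda>''cS''. $''cS'' \<bullet> ($''n'' \<cdot> $$''X'' \<bullet> $''cZ'' \<bullet> $''cS''))"

definition NatP :: tp where
  "NatP = (\<^bold>\<lambda>''nC'':NatC.
     \<^bold>\<forall>''X''\<Colon>\<star>. \<^bold>\<forall>''P''\<Colon>$$''X'' \<^bold>\<rightarrow>\<^sub>\<kappa> \<star>. \<^bold>\<forall>''cZ'':$$''X''. \<^bold>\<forall>''cS'':$$''X'' \<^bold>\<rightarrow> $$''X''.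
       $$''P'' \<^bold>\<bullet> $''cZ'' \<^bold>\<rightarrow>
       (\<^bold>\<forall>''n'':$$''X''. $$''P'' \<^bold>\<bullet> $''n'' \<^bold>\<rightarrow> $$''P'' \<^bold>\<bullet> ($''cS'' \<bullet> $''n'')) \<^bold>\<rightarrow>
       $$''P'' \<^bold>\<bullet> ($''nC'' \<cdot> $$''X'' \<bullet> $''cZ'' \<bullet> $''cS''))"

definition NatR :: tp where
  "NatR = (\<^bold>\<lambda>''nC'':NatC. $''nC'' \<cdot> NatC \<bullet> zeroCN \<bullet> sucCN \<simeq> $''nC'')"

definition Nat :: tp where
  "Nat = (\<^bold>\<iota>''n'':(\<^bold>\<iota>''nC'':NatC. NatP \<^bold>\<bullet> $''nC''). NatR \<^bold>\<bullet> $''n''\<^bold>.1)"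

definition mkNat :: tm where
  "mkNat = (\<^bold>\<lambda>''n''. \<^bold>\<Lambda>''q''. \<langle>$''n'', \<rho> $''q'' \<^bold>- \<beta>\<lbrace>$''n''\<rbrace>\<rangle>)"

definition zeroPN :: tm where
  "zeroPN = (\<^bold>\<Lambda>''X''. \<^bold>\<Lambda>''P''. \<^bold>\<Lambda>''cZ''. \<^bold>\<Lambda>''cS''. \<^bold>\<lambda>''pZ''. \<^bold>\<lambda>''pS''. $''pZ'')"

definition sucPN :: tm where
  "sucPN = (\<^bold>\<lambda>''n''. \<^bold>\<Lambda>''X''. \<^bold>\<Lambda>''P''. \<^bold>\<Lambda>''cZ''. \<^bold>\<Lambda>''cS''. \<^bold>\<lambda>''pZ''. \<^bold>\<lambda>''pS''.
     $''pS'' \<ominus> ($''n''\<^bold>.1\<^bold>.1 \<cdot> $$''X'' \<bullet> $''cZ'' \<bullet> $''cS'')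
       \<bullet> ($''n''\<^bold>.1\<^bold>.2 \<cdot> $$''X'' \<cdot> $$''P'' \<ominus> $''cZ'' \<ominus> $''cS'' \<bullet> $''pZ'' \<bullet> $''pS''))"

definition zeroN :: tm where
  "zeroN = mkNat \<bullet> \<langle>zeroCN, zeroPN\<rangle> \<ominus> \<beta>"

definition sucN :: tm where
  "sucN = (\<^bold>\<lambda>''n''. mkNat \<bullet> \<langle>sucCN \<bullet> $''n''\<^bold>.1\<^bold>.1, sucPN \<bullet> $''n''\<rangle> \<ominus> (\<rho> ($''n''\<^bold>.2) \<^bold>- \<beta>))"

definition elimNat :: tm where
  "elimNat = (\<^bold>\<lambda>''n''. \<^bold>\<Lambda>''P''.
     \<rho> (\<sigma> ($''n''\<^bold>.2)) \<^bold>- ($''n''\<^bold>.1\<^bold>.2 \<cdot> Nat \<cdot> $$''P'' \<ominus> zeroN \<ominus> sucN))"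

definition addN :: tm where
  "addN = (\<^bold>\<lambda>''m''. \<^bold>\<lambda>''n''.
     elimNat \<bullet> $''m'' \<cdot> (\<^bold>\<lambda>''k'':Nat. Nat) \<bullet> $''n'' \<bullet> (\<^bold>\<Lambda>''k''. \<^bold>\<lambda>''r''. sucN \<bullet> $''r''))"

definition multN :: tm where
  "multN = (\<^bold>\<lambda>''m''. \<^bold>\<lambda>''n''.
     elimNat \<bullet> $''m'' \<cdot> (\<^bold>\<lambda>''k'':Nat. Nat) \<bullet> zeroN \<bullet> (\<^bold>\<Lambda>''k''. \<^bold>\<lambda>''r''. addN \<bullet> $''n'' \<bullet> $''r''))"


subsection \<open>Lists\<close>

definition ListC :: tp where
  "ListC = (\<^bold>\<lambda>''A''\<Colon>\<star>.
     \<^bold>\<forall>''X''\<Colon>\<star>. $$''X'' \<^bold>\<rightarrow> ($$''A'' \<^bold>\<rightarrow> $$''X'' \<^bold>\<rightarrow> $$''X'') \<^bold>\<rightarrow> $$''X'')"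

definition nilCL :: tm where
  "nilCL = (\<^bold>\<Lambda>''A''. \<^bold>\<Lambda>''X''. \<^bold>\<lambda>''cN''. \<^bold>\<lambda>''cC''. $''cN'')"

definition consCL :: tm where
  "consCL = (\<^bold>\<Lambda>''A''. \<^bold>\<lambda>''x''. \<^bold>\<lambda>''xs''. \<^bold>\<Lambda>''X''. \<^bold>\<lambda>''cN''. \<^bold>\<lambda>''cC''.
     $''cC'' \<bullet> $''x'' \<bullet> ($''xs'' \<cdot> $$''X'' \<bullet> $''cN'' \<bullet> $''cC''))"

definition ListP :: tp where
  "ListP = (\<^bold>\<lambda>''A''\<Colon>\<star>. \<^bold>\<lambda>''xsC'':(ListC \<^bold>\<cdot> $$''A'').
     \<^bold>\<forall>''X''\<Colon>\<star>. \<^bold>\<forall>''P''\<Colon>$$''X'' \<^bold>\<rightarrow>\<^sub>\<kappa> \<star>.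
     \<^bold>\<forall>''cN'':$$''X''. \<^bold>\<forall>''cC'':$$''A'' \<^bold>\<rightarrow> $$''X'' \<^bold>\<rightarrow> $$''X''.
       $$''P'' \<^bold>\<bullet> $''cN'' \<^bold>\<rightarrow>
       (\<^bold>\<forall>''xs'':$$''X''. \<^bold>\<Pi>''x'':$$''A''.
          $$''P'' \<^bold>\<bullet> $''xs'' \<^bold>\<rightarrow> $$''P'' \<^bold>\<bullet> ($''cC'' \<bullet> $''x'' \<bullet> $''xs'')) \<^bold>\<rightarrow>
       $$''P'' \<^bold>\<bullet> ($''xsC'' \<cdot> $$''X'' \<bullet> $''cN'' \<bullet> $''cC''))"

definition ListR :: tp where
  "ListR = (\<^bold>\<lambda>''A''\<Colon>\<star>. \<^bold>\<lambda>''xsC'':(ListC \<^bold>\<cdot> $$''A'').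
     $''xsC'' \<cdot> (ListC \<^bold>\<cdot> $$''A'') \<bullet> (nilCL \<cdot> $$''A'') \<bullet> (consCL \<cdot> $$''A'') \<simeq> $''xsC'')"

definition List :: tp where
  "List = (\<^bold>\<lambda>''A''\<Colon>\<star>.
     \<^bold>\<iota>''xs'':(\<^bold>\<iota>''xsC'':(ListC \<^bold>\<cdot> $$''A''). ListP \<^bold>\<cdot> $$''A'' \<^bold>\<bullet> $''xsC'').
       ListR \<^bold>\<cdot> $$''A'' \<^bold>\<bullet> $''xs''\<^bold>.1)"

definition mkList :: tm where
  "mkList = (\<^bold>\<Lambda>''A''. \<^bold>\<lambda>''xs''. \<^bold>\<Lambda>''q''. \<langle>$''xs'', \<rho> $''q'' \<^bold>- \<beta>\<lbrace>$''xs''\<rbrace>\<rangle>)"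

definition nilPL :: tm where
  "nilPL = (\<^bold>\<Lambda>''A''. \<^bold>\<Lambda>''X''. \<^bold>\<Lambda>''P''. \<^bold>\<Lambda>''cN''. \<^bold>\<Lambda>''cC''. \<^bold>\<lambda>''pN''. \<^bold>\<lambda>''pC''. $''pN'')"

definition consPL :: tm where
  "consPL = (\<^bold>\<Lambda>''A''. \<^bold>\<lambda>''x''. \<^bold>\<lambda>''xs''.
     \<^bold>\<Lambda>''X''. \<^bold>\<Lambda>''P''. \<^bold>\<Lambda>''cN''. \<^bold>\<Lambda>''cC''. \<^bold>\<lambda>''pN''. \<^bold>\<lambda>''pC''.
     $''pC'' \<ominus> ($''xs''\<^bold>.1\<^bold>.1 \<cdot> $$''X'' \<bullet> $''cN'' \<bullet> $''cC'') \<bullet> $''x''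
       \<bullet> ($''xs''\<^bold>.1\<^bold>.2 \<cdot> $$''X'' \<cdot> $$''P'' \<ominus> $''cN'' \<ominus> $''cC'' \<bullet> $''pN'' \<bullet> $''pC''))"

definition nilL :: tm where
  "nilL = (\<^bold>\<Lambda>''A''. mkList \<cdot> $$''A'' \<bullet> \<langle>nilCL \<cdot> $$''A'', nilPL \<cdot> $$''A''\<rangle> \<ominus> \<beta>)"

definition consL :: tm where
  "consL = (\<^bold>\<Lambda>''A''. \<^bold>\<lambda>''x''. \<^bold>\<lambda>''xs''. mkList \<cdot> $$''A''
     \<bullet> \<langle>consCL \<cdot> $$''A'' \<bullet> $''x'' \<bullet> $''xs''\<^bold>.1\<^bold>.1, consPL \<cdot> $$''A'' \<bullet> $''x'' \<bullet> $''xs''\<rangle>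
     \<ominus> (\<rho> ($''xs''\<^bold>.2) \<^bold>- \<beta>))"

definition elimList :: tm where
  "elimList = (\<^bold>\<Lambda>''A''. \<^bold>\<lambda>''xs''. \<^bold>\<Lambda>''P''.
     \<rho> (\<sigma> ($''xs''\<^bold>.2)) \<^bold>-
       ($''xs''\<^bold>.1\<^bold>.2 \<cdot> (List \<^bold>\<cdot> $$''A'') \<cdot> $$''P'' \<ominus> (nilL \<cdot> $$''A'') \<ominus> (consL \<cdot> $$''A'')))"

definition lengthL :: tm where
  "lengthL = (\<^bold>\<Lambda>''A''. \<^bold>\<lambda>''xs''.
     elimList \<cdot> $$''A'' \<bullet> $''xs'' \<cdot> (\<^bold>\<lambda>''xs'':(List \<^bold>\<cdot> $$''A''). Nat)
       \<bullet> zeroN \<bullet> (\<^bold>\<Lambda>''xs''. \<^bold>\<lambda>''x''. \<^bold>\<lambda>''n''. sucN \<bullet> $''n''))"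


subsection \<open>Vectors\<close>

definition VecC :: tp where
  "VecC = (\<^bold>\<lambda>''A''\<Colon>\<star>. \<^bold>\<lambda>''n'':Nat.
     \<^bold>\<forall>''X''\<Colon>Nat \<^bold>\<rightarrow>\<^sub>\<kappa> \<star>. $$''X'' \<^bold>\<bullet> zeroN \<^bold>\<rightarrow>
       (\<^bold>\<forall>''n'':Nat. $$''A'' \<^bold>\<rightarrow> $$''X'' \<^bold>\<bullet> $''n'' \<^bold>\<rightarrow> $$''X'' \<^bold>\<bullet> (sucN \<bullet> $''n'')) \<^bold>\<rightarrow>
       $$''X'' \<^bold>\<bullet> $''n'')"

definition nilCV :: tm where
  "nilCV = (\<^bold>\<Lambda>''A''. \<^bold>\<Lambda>''X''. \<^bold>\<lambda>''cN''. \<^bold>\<lambda>''cC''. $''cN'')"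

definition consCV :: tm where
  "consCV = (\<^bold>\<Lambda>''A''. \<^bold>\<Lambda>''n''. \<^bold>\<lambda>''x''. \<^bold>\<lambda>''xs''. \<^bold>\<Lambda>''X''. \<^bold>\<lambda>''cN''. \<^bold>\<lambda>''cC''.
     $''cC'' \<ominus> $''n'' \<bullet> $''x'' \<bullet> ($''xs'' \<cdot> $$''X'' \<bullet> $''cN'' \<bullet> $''cC''))"

definition VecP :: tp where
  "VecP = (\<^bold>\<lambda>''A''\<Colon>\<star>. \<^bold>\<lambda>''n'':Nat. \<^bold>\<lambda>''xsC'':(VecC \<^bold>\<cdot> $$''A'' \<^bold>\<bullet> $''n'').
     \<^bold>\<forall>''X''\<Colon>Nat \<^bold>\<rightarrow>\<^sub>\<kappa> \<star>. \<^bold>\<forall>''P''\<Colon>(\<^bold>\<Pi>\<^sub>\<kappa>''n'':Nat. $$''X'' \<^bold>\<bullet> $''n'' \<^bold>\<rightarrow>\<^sub>\<kappa> \<star>).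
     \<^bold>\<forall>''cN'':$$''X'' \<^bold>\<bullet> zeroN.
     \<^bold>\<forall>''cC'':(\<^bold>\<forall>''n'':Nat. $$''A'' \<^bold>\<rightarrow> $$''X'' \<^bold>\<bullet> $''n'' \<^bold>\<rightarrow> $$''X'' \<^bold>\<bullet> (sucN \<bullet> $''n'')).
       $$''P'' \<^bold>\<bullet> zeroN \<^bold>\<bullet> $''cN'' \<^bold>\<rightarrow>
       (\<^bold>\<forall>''n'':Nat. \<^bold>\<forall>''xs'':$$''X'' \<^bold>\<bullet> $''n''. \<^bold>\<Pi>''x'':$$''A''.
          $$''P'' \<^bold>\<bullet> $''n'' \<^bold>\<bullet> $''xs'' \<^bold>\<rightarrow>
          $$''P'' \<^bold>\<bullet> (sucN \<bullet> $''n'') \<^bold>\<bullet> ($''cC'' \<ominus> $''n'' \<bullet> $''x'' \<bullet> $''xs'')) \<^bold>\<rightarrow>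
       $$''P'' \<^bold>\<bullet> $''n'' \<^bold>\<bullet> ($''xsC'' \<cdot> $$''X'' \<bullet> $''cN'' \<bullet> $''cC''))"

definition VecR :: tp where
  "VecR = (\<^bold>\<lambda>''A''\<Colon>\<star>. \<^bold>\<lambda>''n'':Nat. \<^bold>\<lambda>''xsC'':(VecC \<^bold>\<cdot> $$''A'' \<^bold>\<bullet> $''n'').
     $''xsC'' \<cdot> (VecC \<^bold>\<cdot> $$''A'') \<bullet> (nilCV \<cdot> $$''A'') \<bullet> (consCV \<cdot> $$''A'') \<simeq> $''xsC'')"

definition Vec :: tp where
  "Vec = (\<^bold>\<lambda>''A''\<Colon>\<star>. \<^bold>\<lambda>''n'':Nat.
     \<^bold>\<iota>''xs'':(\<^bold>\<iota>''xsC'':(VecC \<^bold>\<cdot> $$''A'' \<^bold>\<bullet> $''n''). VecP \<^bold>\<cdot> $$''A'' \<^bold>\<bullet> $''n'' \<^bold>\<bullet> $''xsC'').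
       VecR \<^bold>\<cdot> $$''A'' \<^bold>\<bullet> $''n'' \<^bold>\<bullet> $''xs''\<^bold>.1)"

definition mkVec :: tm where
  "mkVec = (\<^bold>\<Lambda>''A''. \<^bold>\<Lambda>''n''. \<^bold>\<lambda>''xs''. \<^bold>\<Lambda>''q''. \<langle>$''xs'', \<rho> $''q'' \<^bold>- \<beta>\<lbrace>$''xs''\<rbrace>\<rangle>)"


subsection \<open>Coercion from vectors to lists\<close>

definition v2lC :: tm where
  "v2lC = (\<^bold>\<Lambda>''A''. \<^bold>\<Lambda>''n''. \<^bold>\<lambda>''xs''. \<^bold>\<Lambda>''X''. \<^bold>\<lambda>''cN''. \<^bold>\<lambda>''cC''.
     $''xs''\<^bold>.1\<^bold>.1 \<cdot> (\<^bold>\<lambda>''_'':Nat. $$''X'') \<bullet> $''cN'' \<bullet> (\<^bold>\<Lambda>''_''. $''cC''))"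

definition v2lP :: tm where
  "v2lP = (\<^bold>\<Lambda>''A''. \<^bold>\<Lambda>''n''. \<^bold>\<lambda>''xs''.
     \<^bold>\<Lambda>''X''. \<^bold>\<Lambda>''P''. \<^bold>\<Lambda>''cN''. \<^bold>\<Lambda>''cC''. \<^bold>\<lambda>''pN''. \<^bold>\<lambda>''pC''.
     $''xs''\<^bold>.1\<^bold>.2 \<cdot> (\<^bold>\<lambda>''_'':Nat. $$''X'') \<cdot> (\<^bold>\<lambda>''_'':Nat. $$''P'')
       \<ominus> $''cN'' \<ominus> (\<^bold>\<Lambda>''_''. $''cC'') \<bullet> $''pN'' \<bullet> (\<^bold>\<Lambda>''_''. $''pC''))"

definition v2lR :: tm where
  "v2lR = (\<^bold>\<Lambda>''A''. \<^bold>\<Lambda>''n''. \<^bold>\<lambda>''xs''. $''xs''\<^bold>.2)"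

definition v2l :: tm where
  "v2l = (\<^bold>\<Lambda>''A''. \<^bold>\<Lambda>''n''. \<^bold>\<lambda>''xs''. mkList \<cdot> $$''A''
     \<bullet> \<langle>v2lC \<cdot> $$''A'' \<ominus> $''n'' \<bullet> $''xs'', v2lP \<cdot> $$''A'' \<ominus> $''n'' \<bullet> $''xs''\<rangle>
     \<ominus> (v2lR \<cdot> $$''A'' \<ominus> $''n'' \<bullet> $''xs''))"


subsection \<open>Coercion from lists to vectors\<close>

definition l2vC :: tm where
  "l2vC = (\<^bold>\<Lambda>''A''. \<^bold>\<lambda>''xs''. \<^bold>\<Lambda>''X''. \<^bold>\<lambda>''cN''. \<^bold>\<lambda>''cC''.
     elimList \<cdot> $$''A'' \<bullet> $''xs''
       \<cdot> (\<^bold>\<lambda>''xs'':(List \<^bold>\<cdot> $$''A''). $$''X'' \<^bold>\<bullet> (lengthL \<cdot> $$''A'' \<bullet> $''xs''))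
       \<bullet> $''cN'' \<bullet> (\<^bold>\<Lambda>''xs''. $''cC'' \<ominus> (lengthL \<cdot> $$''A'' \<bullet> $''xs'')))"

definition l2vP :: tm where
  "l2vP = (\<^bold>\<Lambda>''A''. \<^bold>\<lambda>''xs''.
     \<^bold>\<Lambda>''X''. \<^bold>\<Lambda>''P''. \<^bold>\<Lambda>''cN''. \<^bold>\<Lambda>''cC''. \<^bold>\<lambda>''pN''. \<^bold>\<lambda>''pC''.
     elimList \<cdot> $$''A'' \<bullet> $''xs''
       \<cdot> (\<^bold>\<lambda>''xs'':(List \<^bold>\<cdot> $$''A''). $$''P'' \<^bold>\<bullet> (lengthL \<cdot> $$''A'' \<bullet> $''xs'')
            \<^bold>\<bullet> (l2vC \<cdot> $$''A'' \<bullet> $''xs'' \<cdot> $$''X'' \<bullet> $''cN'' \<bullet> $''cC''))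
       \<bullet> $''pN''
       \<bullet> (\<^bold>\<Lambda>''xs''. $''pC'' \<ominus> (lengthL \<cdot> $$''A'' \<bullet> $''xs'')
            \<ominus> (l2vC \<cdot> $$''A'' \<bullet> $''xs'' \<cdot> $$''X'' \<bullet> $''cN'' \<bullet> $''cC'')))"

definition l2vR :: tm where
  "l2vR = (\<^bold>\<Lambda>''A''. \<^bold>\<lambda>''xs''. $''xs''\<^bold>.2)"

definition l2v :: tm where
  "l2v = (\<^bold>\<Lambda>''A''. \<^bold>\<lambda>''xs''. mkVec \<cdot> $$''A'' \<ominus> (lengthL \<cdot> $$''A'' \<bullet> $''xs'')
     \<bullet> \<langle>l2vC \<cdot> $$''A'' \<bullet> $''xs'', l2vP \<cdot> $$''A'' \<bullet> $''xs''\<rangle>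
     \<ominus> (l2vR \<cdot> $$''A'' \<bullet> $''xs''))"


subsection \<open>Length-constrained lists\<close>

text \<open>
  Programs that use a proof term the development leaves open (\<open>lengthPres\<close>, \<open>mapRL\<close>,
  \<open>lengthDistConcat\<close>) or the given list concatenation take it as a parameter.
\<close>

definition VecL :: tp where
  "VecL = (\<^bold>\<lambda>''A''\<Colon>\<star>. \<^bold>\<lambda>''n'':Nat.
     \<^bold>\<iota>''xs'':(List \<^bold>\<cdot> $$''A''). ($''n'' \<simeq> lengthL \<cdot> $$''A'' \<bullet> $''xs''))"

definition mkVecL :: tm where
  "mkVecL = (\<^bold>\<Lambda>''A''. \<^bold>\<Lambda>''n''. \<^bold>\<lambda>''xs''. \<^bold>\<Lambda>''q''. \<langle>$''xs'', \<rho> $''q'' \<^bold>- \<beta>\<lbrace>$''xs''\<rbrace>\<rangle>)"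

definition lengthPres_type :: tp where
  "lengthPres_type = (\<^bold>\<forall>''A''\<Colon>\<star>. \<^bold>\<forall>''n'':Nat. \<^bold>\<Pi>''xs'':(Vec \<^bold>\<cdot> $$''A'' \<^bold>\<bullet> $''n'').
     ($''n'' \<simeq> lengthL \<cdot> $$''A'' \<bullet> (v2l \<cdot> $$''A'' \<ominus> $''n'' \<bullet> $''xs'')))"

definition v2u :: "tm \<Rightarrow> tm" where
  "v2u lengthPres = (\<^bold>\<Lambda>''A''. \<^bold>\<Lambda>''n''. \<^bold>\<lambda>''xs''.
     mkVecL \<cdot> $$''A'' \<ominus> $''n'' \<bullet> (v2l \<cdot> $$''A'' \<ominus> $''n'' \<bullet> $''xs'')
       \<ominus> (\<sigma> (lengthPres \<cdot> $$''A'' \<ominus> $''n'' \<bullet> $''xs'')))"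

definition u2l :: tm where
  "u2l = (\<^bold>\<Lambda>''A''. \<^bold>\<Lambda>''n''. \<^bold>\<lambda>''xs''. $''xs''\<^bold>.1)"


subsection \<open>Map\<close>

definition mapCL :: tm where
  "mapCL = (\<^bold>\<Lambda>''A''. \<^bold>\<Lambda>''B''. \<^bold>\<lambda>''f''. \<^bold>\<lambda>''xs''. \<^bold>\<Lambda>''X''. \<^bold>\<lambda>''cN''. \<^bold>\<lambda>''cC''.
     $''xs''\<^bold>.1\<^bold>.1 \<cdot> $$''X'' \<bullet> $''cN'' \<bullet> (\<^bold>\<lambda>''x''. $''cC'' \<bullet> ($''f'' \<bullet> $''x'')))"

definition mapPL :: tm where
  "mapPL = (\<^bold>\<Lambda>''A''. \<^bold>\<Lambda>''B''. \<^bold>\<lambda>''f''. \<^bold>\<lambda>''xs''.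
     \<^bold>\<Lambda>''X''. \<^bold>\<Lambda>''P''. \<^bold>\<Lambda>''cN''. \<^bold>\<Lambda>''cC''. \<^bold>\<lambda>''pN''. \<^bold>\<lambda>''pC''.
     $''xs''\<^bold>.1\<^bold>.2 \<cdot> $$''X'' \<cdot> $$''P'' \<ominus> $''cN'' \<ominus> (\<^bold>\<lambda>''x''. $''cC'' \<bullet> ($''f'' \<bullet> $''x''))
       \<bullet> $''pN'' \<bullet> (\<^bold>\<Lambda>''xsC''. \<^bold>\<lambda>''x''. $''pC'' \<ominus> $''xsC'' \<bullet> ($''f'' \<bullet> $''x'')))"

definition mapRL_type :: tp where
  "mapRL_type = (\<^bold>\<forall>''A''\<Colon>\<star>. \<^bold>\<forall>''B''\<Colon>\<star>.
     \<^bold>\<Pi>''f'':$$''A'' \<^bold>\<rightarrow> $$''B''. \<^bold>\<Pi>''xs'':(List \<^bold>\<cdot> $$''A'').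
       ListR \<^bold>\<cdot> $$''B'' \<^bold>\<bullet> (mapCL \<cdot> $$''A'' \<cdot> $$''B'' \<bullet> $''f'' \<bullet> $''xs''))"

definition mapL :: "tm \<Rightarrow> tm" where
  "mapL mapRL = (\<^bold>\<Lambda>''A''. \<^bold>\<Lambda>''B''. \<^bold>\<lambda>''f''. \<^bold>\<lambda>''xs''. mkList \<cdot> $$''B''
     \<bullet> \<langle>mapCL \<cdot> $$''A'' \<cdot> $$''B'' \<bullet> $''f'' \<bullet> $''xs'', mapPL \<cdot> $$''A'' \<cdot> $$''B'' \<bullet> $''f'' \<bullet> $''xs''\<rangle>
     \<ominus> (mapRL \<cdot> $$''A'' \<cdot> $$''B'' \<bullet> $''f'' \<bullet> $''xs''))"


subsection \<open>Nested coercions\<close>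

definition v2l_v2l :: "tm \<Rightarrow> tm" where
  "v2l_v2l mapRL = (\<^bold>\<Lambda>''A''. \<^bold>\<Lambda>''n''. \<^bold>\<Lambda>''m''. \<^bold>\<lambda>''xss''.
     mapL mapRL \<cdot> (Vec \<^bold>\<cdot> $$''A'' \<^bold>\<bullet> $''n'') \<cdot> (List \<^bold>\<cdot> $$''A'')
       \<bullet> (v2l \<cdot> $$''A'' \<ominus> $''n'')
       \<bullet> (v2l \<cdot> (Vec \<^bold>\<cdot> $$''A'' \<^bold>\<bullet> $''n'') \<ominus> $''m'' \<bullet> $''xss''))"

definition v2u_v2l :: "tm \<Rightarrow> tm \<Rightarrow> tm" where
  "v2u_v2l mapRL lengthPres = (\<^bold>\<Lambda>''A''. \<^bold>\<Lambda>''n''. \<^bold>\<Lambda>''m''. \<^bold>\<lambda>''xss''.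
     mapL mapRL \<cdot> (Vec \<^bold>\<cdot> $$''A'' \<^bold>\<bullet> $''n'') \<cdot> (VecL \<^bold>\<cdot> $$''A'' \<^bold>\<bullet> $''n'')
       \<bullet> (v2u lengthPres \<cdot> $$''A'' \<ominus> $''n'')
       \<bullet> (v2l \<cdot> (Vec \<^bold>\<cdot> $$''A'' \<^bold>\<bullet> $''n'') \<ominus> $''m'' \<bullet> $''xss''))"

definition u2l_l2l :: "tm \<Rightarrow> tm" where
  "u2l_l2l mapRL = (\<^bold>\<Lambda>''A''. \<^bold>\<Lambda>''n''. \<^bold>\<lambda>''xss''.
     mapL mapRL \<cdot> (VecL \<^bold>\<cdot> $$''A'' \<^bold>\<bullet> $''n'') \<cdot> (List \<^bold>\<cdot> $$''A'')
       \<bullet> (u2l \<cdot> $$''A'' \<ominus> $''n'') \<bullet> $''xss'')"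


subsection \<open>Concatenation\<close>

definition concatL_type :: tp where
  "concatL_type = (\<^bold>\<forall>''A''\<Colon>\<star>. List \<^bold>\<cdot> (List \<^bold>\<cdot> $$''A'') \<^bold>\<rightarrow> List \<^bold>\<cdot> $$''A'')"

text \<open>
  Erased lists with given elements; \<open>flattens\<close> is independent of how concatenation is programmed.
\<close>

fun list_u :: "utm list \<Rightarrow> utm" where
  "list_u [] = |nilL|"
| "list_u (t # ts) = UApp (UApp |consL| t) (list_u ts)"

definition flattens :: "tm \<Rightarrow> bool" where
  "flattens f \<longleftrightarrow> (\<forall>tss. (\<forall>ts \<in> set tss. \<forall>t \<in> set ts. lc_u 0 t) \<longrightarrow>
     UApp |f| (list_u (map list_u tss)) =\<^sub>\<beta>\<^sub>\<eta> list_u (concat tss))"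

definition lengthDistConcat_type :: "tm \<Rightarrow> tm \<Rightarrow> tp" where
  "lengthDistConcat_type mapRL concatL = (\<^bold>\<forall>''A''\<Colon>\<star>. \<^bold>\<forall>''n'':Nat.
     \<^bold>\<Pi>''xss'':(List \<^bold>\<cdot> (VecL \<^bold>\<cdot> $$''A'' \<^bold>\<bullet> $''n'')).
       (multN \<bullet> (lengthL \<cdot> (VecL \<^bold>\<cdot> $$''A'' \<^bold>\<bullet> $''n'') \<bullet> $''xss'') \<bullet> $''n'' \<simeq>
        lengthL \<cdot> $$''A'' \<bullet> (concatL \<cdot> $$''A'' \<bullet> (u2l_l2l mapRL \<cdot> $$''A'' \<ominus> $''n'' \<bullet> $''xss''))))"

definition concatV :: "tm \<Rightarrow> tm \<Rightarrow> tm \<Rightarrow> tm \<Rightarrow> tm" where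
  "concatV mapRL lengthPres concatL lengthDistConcat = (\<^bold>\<Lambda>''A''. \<^bold>\<Lambda>''n''. \<^bold>\<Lambda>''m''. \<^bold>\<lambda>''xss''.
     \<rho> ((v2u lengthPres \<cdot> (Vec \<^bold>\<cdot> $$''A'' \<^bold>\<bullet> $''n'') \<ominus> $''m'' \<bullet> $''xss'')\<^bold>.2) \<^bold>-
     \<rho> (lengthDistConcat \<cdot> $$''A'' \<ominus> $''n''
          \<bullet> (v2u_v2l mapRL lengthPres \<cdot> $$''A'' \<ominus> $''n'' \<ominus> $''m'' \<bullet> $''xss'')) \<^bold>-
     (l2v \<cdot> $$''A'' \<bullet> (concatL \<cdot> $$''A'' \<bullet> (v2l_v2l mapRL \<cdot> $$''A'' \<ominus> $''n'' \<ominus> $''m'' \<bullet> $''xss''))))"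

end

theory Submission
  imports Defs
begin

text \<open>
  The coercions \<open>v2l\<close> and \<open>l2v\<close> erase to eta-expansions of the identity, and so does mapping
  an identity over a list. Since the erasure of \<open>\<rho>\<close> discards the equality proof,
  \<open>concatV\<close> erases to \<open>\<lambda>xss. |concatL| xss\<close> up to identities, which is an eta-expansion of
  \<open>|concatL|\<close> because erasures of typed terms are closed.
\<close>

lemma bind_u_fresh: "x \<notin> fv_u t \<Longrightarrow> bind_u k x t = t"
proof (induction t arbitrary: k)
  case (UVar v)
  then show ?case by (cases v) auto
qed auto

lemma drop_u_lc: "lc_u k t \<Longrightarrow> drop_u k t = t"
proof (induction t arbitrary: k)
  case (UVar v)
  then show ?case by (cases v) auto
qed auto

lemma lc_bind_u: "lc_u k t \<Longrightarrow> lc_u (Suc k) (bind_u k x t)"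
proof (induction t arbitrary: k)
  case (UVar v)
  then show ?case by (cases v) auto
qed auto

lemma lc_drop_u: "lc_u (Suc k) t \<Longrightarrow> j \<le> k \<Longrightarrow> lc_u k (drop_u j t)"
proof (induction t arbitrary: k j)
  case (UVar v)
  then show ?case by (cases v) auto
qed auto

lemma fv_bind_u: "fv_u (bind_u k x t) = fv_u t - {x}"
proof (induction t arbitrary: k)
  case (UVar v)
  then show ?case by (cases v) auto
qed auto

lemma fv_drop_u: "fv_u (drop_u k t) = fv_u t"
proof (induction t arbitrary: k)
  case (UVar v)
  then show ?case by (cases v) auto
qed auto

text \<open>Lets erasure commute with binding below an erased binder: the new index lies above the
  removed index \<open>j\<close>, so removal lowers it from \<open>Suc k\<close> to
  \<open>k\<close>.\<close>

lemma drop_bind_u: "j \<le> k \<Longrightarrow> drop_u j (bind_u (Suc k) x t) = bind_u k x (drop_u j t)"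
proof (induction t arbitrary: j k)
  case (UVar v)
  then show ?case by (cases v) auto
qed auto

lemma erase_bind: "|bind_tm k x t| = bind_u k x |t|"
  \<comment> \<open>Types and kinds leave no trace in an erasure, so their predicates in the mutual
    induction are trivial.\<close>
  by (induction t arbitrary: k rule: tm.induct[of _ "\<lambda>_. True" "\<lambda>_. True"])
    (auto simp: drop_bind_u)

lemma lc_erase: "lc_tm k t \<Longrightarrow> lc_u k |t|"
  by (induction t arbitrary: k rule: tm.induct[of _ "\<lambda>_. True" "\<lambda>_. True"])
    (auto simp: lc_drop_u)

lemma erase_lam: "|\<^bold>\<lambda>x. t| = ulam x |t|"
  by (simp add: lam_def ulam_def erase_bind)

text \<open>A fresh \<open>x\<close> receives no index, and a locally closed erasure has no loose
  index to lower, so the filler in \<open>drop_u\<close> never appears.\<close>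

lemma erase_ilam: "x \<notin> fv_u |t| \<Longrightarrow> lc_u 0 |t| \<Longrightarrow> |\<^bold>\<Lambda>x. t| = |t|"
  by (simp add: ilam_def erase_bind bind_u_fresh drop_u_lc)

lemma lc_ulam: "lc_u 0 t \<Longrightarrow> lc_u 0 (ulam x t)"
  by (simp add: ulam_def lc_bind_u)

lemma fv_ulam: "fv_u (ulam x t) = fv_u t - {x}"
  by (simp add: ulam_def fv_bind_u)

lemma lc_erase_ilam: "lc_u 0 |t| \<Longrightarrow> lc_u 0 |\<^bold>\<Lambda>x. t|"
  by (simp add: ilam_def erase_bind lc_bind_u lc_drop_u)

lemma fv_erase_ilam: "fv_u |\<^bold>\<Lambda>x. t| = fv_u |t| - {x}"
  by (simp add: ilam_def erase_bind fv_bind_u fv_drop_u)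

text \<open>Serves for \<open>concatL\<close>, whose code is not given. The term in
  \<open>BetaW\<close> is untyped; there the side conditions of the rule supply the claim.\<close>

lemma typing_scoped:
  assumes "\<Gamma> \<turnstile> t \<^bold>: T"
  shows "lc_u 0 |t| \<and> fv_u |t| \<subseteq> tmvars \<Gamma>"
proof -
  have "(wf_ctx \<Gamma>1 \<longrightarrow> True) \<and> (okkind \<Gamma>2 K \<longrightarrow> True) \<and> (kinding \<Gamma>3 S L \<longrightarrow> True) \<and>
    (typing \<Gamma> t T \<longrightarrow> lc_u 0 |t| \<and> fv_u |t| \<subseteq> tmvars \<Gamma>)" for \<Gamma>1 \<Gamma>2 K \<Gamma>3 S L
    by (induction rule: wf_ctx_okkind_kinding_typing.induct)
      (auto simp: erase_lam lc_ulam fv_ulam lc_erase_ilam fv_erase_ilam lc_erase tmvars_def)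
  then show ?thesis using assms by blast
qed

declare be_trans [trans]

lemma beta_ulam:
  "lc_u 0 t \<Longrightarrow> lc_u 0 u \<Longrightarrow> UApp (ulam x t) u =\<^sub>\<beta>\<^sub>\<eta> inst_u 0 u (bind_u 0 x t)"
  unfolding ulam_def by (rule be_beta) (simp_all add: lc_bind_u)

lemma eta_ulam:
  assumes "x \<notin> fv_u t" "lc_u 0 t"
  shows "ulam x (UApp t (UVar (Fr x))) =\<^sub>\<beta>\<^sub>\<eta> t"
  using be_eta[OF assms(2)] assms(1) by (simp add: ulam_def bind_u_fresh)

abbreviation id_u :: utm where
  "id_u \<equiv> ULam (UVar (Bd 0))"

lemma ulam_var: "ulam x (UVar (Fr x)) = id_u"
  by (simp add: ulam_def)

lemma id_app:
  assumes "t =\<^sub>\<beta>\<^sub>\<eta> id_u" "lc_u 0 u"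
  shows "UApp t u =\<^sub>\<beta>\<^sub>\<eta> u"
  using be_trans[OF be_app[OF assms(1) be_refl] be_beta[of "UVar (Bd 0)" u]] assms(2) by simp

lemma id_ulam: "t =\<^sub>\<beta>\<^sub>\<eta> UVar (Fr x) \<Longrightarrow> ulam x t =\<^sub>\<beta>\<^sub>\<eta> id_u"
  using be_lam[of t "UVar (Fr x)" x] by (simp add: ulam_var)

text \<open>The shape of an erased fold that passes on both constructors. Contracting
  \<open>y\<close> first works because \<open>x \<noteq> y\<close> keeps \<open>y\<close> out of
  \<open>s x\<close>.\<close>

lemma eta2_ulam:
  assumes "t =\<^sub>\<beta>\<^sub>\<eta> UApp (UApp s (UVar (Fr x))) (UVar (Fr y))"
    and "lc_u 0 s" "x \<notin> fv_u s" "y \<notin> fv_u s" "x \<noteq> y"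
  shows "ulam x (ulam y t) =\<^sub>\<beta>\<^sub>\<eta> s"
proof -
  have "ulam y t =\<^sub>\<beta>\<^sub>\<eta> ulam y (UApp (UApp s (UVar (Fr x))) (UVar (Fr y)))"
    using assms(1) by (rule be_lam)
  also have "\<dots> =\<^sub>\<beta>\<^sub>\<eta> UApp s (UVar (Fr x))"
    using assms by (intro eta_ulam) auto
  finally have "ulam x (ulam y t) =\<^sub>\<beta>\<^sub>\<eta> ulam x (UApp s (UVar (Fr x)))"
    by (rule be_lam)
  then show ?thesis
    by (rule be_trans) (use assms in \<open>auto intro: eta_ulam\<close>)
qed

lemmas erase_simps = erase_lam erase_ilam fv_ulam lc_ulam ulam_var

text \<open>The motive and the constructors are type and implicit arguments, so only
  \<open>xs\<close> is left of the body.\<close>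

lemma erase_elimList: "|elimList| = id_u"
  by (simp add: elimList_def erase_simps)

lemma erase_mkList: "|mkList| = id_u"
  by (simp add: mkList_def erase_simps)

lemma erase_mkVec: "|mkVec| = id_u"
  by (simp add: mkVec_def erase_simps)

text \<open>Without the implicit length, the step case of the elimination is plain
  \<open>cC\<close>, so \<open>l2vC\<close> collapses by one beta and two eta steps. The scoping
  facts serve to erase callers of \<open>l2v\<close>.\<close>

lemma erase_l2v: "|l2v| =\<^sub>\<beta>\<^sub>\<eta> id_u" "lc_u 0 |l2v|" "fv_u |l2v| = {}"
proof -
  let ?xs = "UVar (Fr ''xs'')" and ?cN = "UVar (Fr ''cN'')" and ?cC = "UVar (Fr ''cC'')"
  have "|l2vC| = ulam ''xs'' (ulam ''cN'' (ulam ''cC'' (UApp (UApp (UApp id_u ?xs) ?cN) ?cC)))"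
    by (simp add: l2vC_def erase_simps erase_elimList)
  moreover have "\<dots> =\<^sub>\<beta>\<^sub>\<eta> id_u"
    by (intro id_ulam eta2_ulam be_app id_app be_refl) auto
  ultimately have C: "|l2vC| =\<^sub>\<beta>\<^sub>\<eta> id_u" and lc: "lc_u 0 |l2vC|" and fv: "fv_u |l2vC| = {}"
    by (auto simp: fv_ulam lc_ulam)
  \<comment> \<open>A pair erases to its first component, so only \<open>l2vC\<close> remains, under
    the identity \<open>|mkVec|\<close>.\<close>
  have eq: "|l2v| = ulam ''xs'' (UApp id_u (UApp |l2vC| ?xs))"
    by (simp add: l2v_def erase_simps erase_mkVec lc fv)
  have "ulam ''xs'' (UApp id_u (UApp |l2vC| ?xs)) =\<^sub>\<beta>\<^sub>\<eta> id_u"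
    by (intro id_ulam be_trans[OF id_app] id_app C be_refl) (simp add: lc)+
  then show "|l2v| =\<^sub>\<beta>\<^sub>\<eta> id_u" by (simp add: eq)
  show "lc_u 0 |l2v|" "fv_u |l2v| = {}"
    by (auto simp: eq fv_ulam lc_ulam lc fv)
qed

text \<open>With index arguments erased, a vector's fold has the shape of a list's fold.\<close>

lemma erase_v2l: "|v2l| =\<^sub>\<beta>\<^sub>\<eta> id_u" "lc_u 0 |v2l|" "fv_u |v2l| = {}"
proof -
  let ?xs = "UVar (Fr ''xs'')" and ?cN = "UVar (Fr ''cN'')" and ?cC = "UVar (Fr ''cC'')"
  have "|v2lC| = ulam ''xs'' (ulam ''cN'' (ulam ''cC'' (UApp (UApp ?xs ?cN) ?cC)))"
    by (simp add: v2lC_def erase_simps)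
  moreover have "\<dots> =\<^sub>\<beta>\<^sub>\<eta> id_u"
    by (intro id_ulam eta2_ulam be_refl) auto
  ultimately have C: "|v2lC| =\<^sub>\<beta>\<^sub>\<eta> id_u" and lc: "lc_u 0 |v2lC|" and fv: "fv_u |v2lC| = {}"
    by (auto simp: fv_ulam lc_ulam)
  have eq: "|v2l| = ulam ''xs'' (UApp id_u (UApp |v2lC| ?xs))"
    by (simp add: v2l_def erase_simps erase_mkList lc fv)
  have "ulam ''xs'' (UApp id_u (UApp |v2lC| ?xs)) =\<^sub>\<beta>\<^sub>\<eta> id_u"
    by (intro id_ulam be_trans[OF id_app] id_app C be_refl) (simp add: lc)+
  then show "|v2l| =\<^sub>\<beta>\<^sub>\<eta> id_u" by (simp add: eq)
  show "lc_u 0 |v2l|" "fv_u |v2l| = {}"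
    by (auto simp: eq fv_ulam lc_ulam lc fv)
qed

lemma erase_mapCL:
  "|mapCL| = ulam ''f'' (ulam ''xs'' (ulam ''cN'' (ulam ''cC''
     (UApp (UApp (UVar (Fr ''xs'')) (UVar (Fr ''cN'')))
       (ulam ''x'' (UApp (UVar (Fr ''cC'')) (UApp (UVar (Fr ''f'')) (UVar (Fr ''x'')))))))))"
  by (simp add: mapCL_def erase_simps)

text \<open>The identity law of map: the step function contracts to \<open>cC\<close>, leaving a
  fold that eta-reduces to \<open>xs\<close>.\<close>

lemma mapCL_id: "UApp |mapCL| id_u =\<^sub>\<beta>\<^sub>\<eta> id_u"
proof -
  let ?xs = "UVar (Fr ''xs'')" and ?cN = "UVar (Fr ''cN'')" and ?cC = "UVar (Fr ''cC'')"
    and ?x = "UVar (Fr ''x'')"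
  have "UApp |mapCL| id_u =\<^sub>\<beta>\<^sub>\<eta> ulam ''xs'' (ulam ''cN'' (ulam ''cC''
     (UApp (UApp ?xs ?cN) (ulam ''x'' (UApp ?cC (UApp id_u ?x))))))"
    \<comment> \<open>In de Bruijn form the contractum is literally the right-hand side.\<close>
    unfolding erase_mapCL by (rule be_trans[OF beta_ulam]) (auto simp: ulam_def intro: be_refl)
  also have "\<dots> =\<^sub>\<beta>\<^sub>\<eta> id_u"
  proof (intro id_ulam eta2_ulam be_app be_refl)
    have "ulam ''x'' (UApp ?cC (UApp id_u ?x)) =\<^sub>\<beta>\<^sub>\<eta> ulam ''x'' (UApp ?cC ?x)"
      by (intro be_lam be_app id_app be_refl) auto
    then show "ulam ''x'' (UApp ?cC (UApp id_u ?x)) =\<^sub>\<beta>\<^sub>\<eta> ?cC"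
      by (rule be_trans) (auto intro: eta_ulam)
  qed auto
  finally show ?thesis .
qed

text \<open>The proof \<open>R\<close> occurs only inside an implicit argument, so it
  vanishes.\<close>

lemma erase_mapL:
  "|mapL R| = ulam ''f'' (ulam ''xs''
     (UApp id_u (UApp (UApp |mapCL| (UVar (Fr ''f''))) (UVar (Fr ''xs'')))))"
  by (simp add: mapL_def erase_simps erase_mkList erase_mapCL insert_Diff_if)

lemma mapL_id:
  assumes "t =\<^sub>\<beta>\<^sub>\<eta> id_u"
  shows "UApp |mapL R| t =\<^sub>\<beta>\<^sub>\<eta> id_u"
proof -
  let ?xs = "UVar (Fr ''xs'')"
  have "UApp |mapL R| t =\<^sub>\<beta>\<^sub>\<eta> UApp |mapL R| id_u"
    \<comment> \<open>Passing to \<open>id_u\<close> first gives the beta step a locally closed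
      argument, which \<open>t\<close> is not assumed to be.\<close>
    using assms by (intro be_app be_refl)
  also have "\<dots> =\<^sub>\<beta>\<^sub>\<eta> ulam ''xs'' (UApp id_u (UApp (UApp |mapCL| id_u) ?xs))"
    unfolding erase_mapL erase_mapCL
    by (rule be_trans[OF beta_ulam]) (auto simp: ulam_def intro: be_refl)
  also have "\<dots> =\<^sub>\<beta>\<^sub>\<eta> id_u"
    by (intro id_ulam be_trans[OF id_app[OF be_refl]] id_app[OF mapCL_id])
      (simp_all add: erase_mapCL lc_ulam)
  finally show ?thesis .
qed

lemma erase_v2l_v2l:
  "|v2l_v2l R| =\<^sub>\<beta>\<^sub>\<eta> id_u" "lc_u 0 |v2l_v2l R|" "fv_u |v2l_v2l R| = {}"
proof -
  let ?xss = "UVar (Fr ''xss'')"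
  have scoped: "lc_u 0 |mapL R|" "fv_u |mapL R| = {}"
    by (auto simp: erase_mapL erase_mapCL fv_ulam lc_ulam)
  have eq: "|v2l_v2l R| = ulam ''xss'' (UApp (UApp |mapL R| |v2l| ) (UApp |v2l| ?xss))"
    by (simp add: v2l_v2l_def erase_simps scoped erase_v2l(2,3))
  \<comment> \<open>The mapped coercion is an identity, hence so is the map over the outer
    list.\<close>
  have "UApp (UApp |mapL R| |v2l| ) (UApp |v2l| ?xss) =\<^sub>\<beta>\<^sub>\<eta> UApp |v2l| ?xss"
    by (rule id_app[OF mapL_id[OF erase_v2l(1)]]) (simp add: erase_v2l(2))
  also have "\<dots> =\<^sub>\<beta>\<^sub>\<eta> ?xss"
    by (rule id_app[OF erase_v2l(1)]) simp
  finally have "ulam ''xss'' (UApp (UApp |mapL R| |v2l| ) (UApp |v2l| ?xss)) =\<^sub>\<beta>\<^sub>\<eta> id_u"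
    by (rule id_ulam)
  then show "|v2l_v2l R| =\<^sub>\<beta>\<^sub>\<eta> id_u" by (simp add: eq)
  show "lc_u 0 |v2l_v2l R|" "fv_u |v2l_v2l R| = {}"
    by (auto simp: eq fv_ulam lc_ulam scoped erase_v2l(2,3))
qed

theorem theorem5p10:
  fixes mapRL lengthPres concatL lengthDistConcat :: tm
  assumes "[] \<turnstile> mapRL \<^bold>: mapRL_type"
    and "[] \<turnstile> lengthPres \<^bold>: lengthPres_type"
    and "[] \<turnstile> concatL \<^bold>: concatL_type"
    and "flattens concatL"
    and "[] \<turnstile> lengthDistConcat \<^bold>: lengthDistConcat_type mapRL concatL"
  shows "|concatV mapRL lengthPres concatL lengthDistConcat| =\<^sub>\<beta>\<^sub>\<eta> |concatL|"
proof -
  let ?xss = "UVar (Fr ''xss'')"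
  have scoped: "lc_u 0 |concatL|" "fv_u |concatL| = {}"
    using typing_scoped[OF assms(3)] by (auto simp: tmvars_def)
  \<comment> \<open>Both rewrites disappear, and with them \<open>v2u\<close>,
    \<open>v2u_v2l\<close> and \<open>lengthDistConcat\<close>.\<close>
  have eq: "|concatV mapRL lengthPres concatL lengthDistConcat| =
      ulam ''xss'' (UApp |l2v| (UApp |concatL| (UApp |v2l_v2l mapRL| ?xss)))"
    by (simp add: concatV_def erase_simps scoped erase_v2l_v2l(2,3) erase_l2v(2,3))
  \<comment> \<open>The outer \<open>l2v\<close> is removed first, then the inner coercion inside
    the argument of \<open>concatL\<close>.\<close>
  have "ulam ''xss'' (UApp |l2v| (UApp |concatL| (UApp |v2l_v2l mapRL| ?xss)))
      =\<^sub>\<beta>\<^sub>\<eta> ulam ''xss'' (UApp |concatL| ?xss)"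
    by (intro be_lam be_trans[OF id_app[OF erase_l2v(1)]] be_app id_app[OF erase_v2l_v2l(1)] be_refl)
      (simp_all add: scoped erase_v2l_v2l(2))
  also have "\<dots> =\<^sub>\<beta>\<^sub>\<eta> |concatL|"
    by (intro eta_ulam) (simp_all add: scoped)
  finally show ?thesis unfolding eq .
qed

end
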